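(* Let $X$ be a systolic simplicial complex and let $v_0$ be a vertex of $X$. Pick an integer $n>0$. Then for any simplex $\sigma\subset S_n(v_0,X)$, the intersection $\mathrm{Res}(\sigma,X)\cap S_{n-1}(v_0,X)$ is a non-empty simplex. (This simplex is called the projection of $\sigma$ onto $S_{n-1}(v_0,X)$ and is denoted by $\pi_{v_0}(\sigma)$.)
   Context: Simplicial complexes are not assumed finite dimensional or locally finite, and are equipped with the CW topology. A simplicial complex is flag if every set of vertices pairwise connected by edges spans a simplex of the complex (the set is arbitrary, not assumed finite; since a simplex has finitely many vertices, a flag complex contains no infinite set of pairwise adjacent vertices). A cycle is a subcomplex homeomorphic to $S^1$; its length is its number of edges. A diagonal of a cycle is an edge (of the ambient complex) connecting two nonconsecutive vertices of the cycle. The link $X_v$ of a vertex $v$ is the subcomplex of all simplices that do not contain $v$ but together with $v$ span a simplex of $X$. For $k\ge 4$, a simplicial complex is $k$-large if it is flag and every cycle of length $m$ with $4\le m<k$ has a diagonal; it is locally $k$-large if the links of all its vertices are $k$-large. A simplicial complex is $k$-systolic if it is locally $k$-large, connected and simply connected. "Systolic" means $6$-systolic. The span of a set of vertices is the largest subcomplex of $X$ having that set as its vertex set; the span of a collection of subcomplexes is the span of all their vertices. The residue $\mathrm{Res}(\sigma,X)$ of a simplex $\sigma$ is the subcomplex spanned by all simplices of $X$ that contain $\sigma$. For vertices $u,w$, $|u,w|$ is the number of edges in a shortest edge path between them in the $1$-skeleton $X^{(1)}$. The combinatorial sphere is $S_n(v_0,X)=\mathrm{span}\{v \text{ a vertex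 of } X\mid |v,v_0|=n\}$. *)

theory Defs
  imports "HOL-Analysis.Analysis"
begin

section \<open>Abstract simplicial complexes\<close>

text \<open>
  A complex is the family of its simplices, each one given by its (finite, non-empty) set of
  vertices. The empty set is never a simplex. There is no bound on dimension or local size.
\<close>

definition simp_complex :: "'a set set \<Rightarrow> bool" where
  "simp_complex K \<longleftrightarrow>
     (\<forall>s\<in>K. finite s \<and> s \<noteq> {}) \<and> (\<forall>s\<in>K. \<forall>t. t \<subseteq> s \<and> t \<noteq> {} \<longrightarrow> t \<in> K)"

definition subcomplex :: "'a set set \<Rightarrow> 'a set set \<Rightarrow> bool" where
  "subcomplex L K \<longleftrightarrow> simp_complex L \<and> L \<subseteq> K"

definition vertices :: "'a set set \<Rightarrow> 'a set" where
  "vertices K = \<Union>K"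

definition edges :: "'a set set \<Rightarrow> 'a set set" where
  "edges K = {e \<in> K. card e = 2}"

text \<open>A simplex regarded as a complex: all its faces, including itself.\<close>

definition full_simplex :: "'a set \<Rightarrow> 'a set set" where
  "full_simplex s = {t. t \<subseteq> s \<and> t \<noteq> {}}"

definition cx_span :: "'a set set \<Rightarrow> 'a set \<Rightarrow> 'a set set" where
  "cx_span K A = {s \<in> K. s \<subseteq> A}"

definition cx_link :: "'a set set \<Rightarrow> 'a \<Rightarrow> 'a set set" where
  "cx_link K v = {s \<in> K. v \<notin> s \<and> insert v s \<in> K}"

definition cx_residue :: "'a set set \<Rightarrow> 'a set \<Rightarrow> 'a set set" where
  "cx_residue K s = cx_span K (\<Union>{t \<in> K. s \<subseteq> t})"


section \<open>Geometric realization with the CW topology\<close>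

text \<open>Points are given by their barycentric coordinates.\<close>

definition geom_simplex :: "'a set \<Rightarrow> ('a \<Rightarrow> real) set" where
  "geom_simplex s = {x. (\<forall>v. 0 \<le> x v) \<and> (\<forall>v. v \<notin> s \<longrightarrow> x v = 0) \<and> (\<Sum>v\<in>s. x v) = 1}"

text \<open>
  The weak topology: a set is open iff it meets each closed simplex in an open subset of that
  simplex. The product topology on the function type induces on \<^term>\<open>geom_simplex s\<close>, for
  finite \<^term>\<open>s\<close>, the usual Euclidean topology.
\<close>

definition realization :: "'a set set \<Rightarrow> ('a \<Rightarrow> real) topology" where
  "realization K =
     topology (\<lambda>U. U \<subseteq> (\<Union>s\<in>K. geom_simplex s) \<and>
                   (\<forall>s\<in>K. openin (top_of_set (geom_simplex s)) (U \<inter> geom_simplex s)))"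

lemma openin_realization:
  "openin (realization K) U \<longleftrightarrow>
     U \<subseteq> (\<Union>s\<in>K. geom_simplex s) \<and>
     (\<forall>s\<in>K. openin (top_of_set (geom_simplex s)) (U \<inter> geom_simplex s))"
proof -
  have Int: "openin (top_of_set A) (S \<inter> T \<inter> A)"
    if "openin (top_of_set A) (S \<inter> A)" "openin (top_of_set A) (T \<inter> A)"
    for A S T :: "('a \<Rightarrow> real) set"
    using openin_Int[OF that] by (simp add: Int_ac)
  have Union: "openin (top_of_set A) (\<Union>\<K> \<inter> A)"
    if "\<And>S. S \<in> \<K> \<Longrightarrow> openin (top_of_set A) (S \<inter> A)"
    for A :: "('a \<Rightarrow> real) set" and \<K>
    unfolding Int_Union2 by (rule openin_Union) (use that in auto)
  have "istopology (\<lambda>U. U \<subseteq> (\<Union>s\<in>K. geom_simplex s) \<and>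
          (\<forall>s\<in>K. openin (top_of_set (geom_simplex s)) (U \<inter> geom_simplex s)))"
    unfolding istopology_def by (intro conjI allI impI ballI Int Union) blast+
  then show ?thesis
    unfolding realization_def by simp
qed

lemma topspace_realization: "topspace (realization K) = (\<Union>s\<in>K. geom_simplex s)"
proof -
  have "(\<Union>t\<in>K. geom_simplex t) \<inter> geom_simplex s = geom_simplex s" if "s \<in> K" for s
    using that by blast
  then have "openin (realization K) (\<Union>s\<in>K. geom_simplex s)"
    by (simp add: openin_realization)
  then show ?thesis
    using openin_realization[of K "topspace (realization K)"]
    by (intro subset_antisym openin_subset) (simp_all add: openin_topspace)
qed

text \<open>
  The second condition says that the fundamental group at every base point is trivial: every
  loop is homotopic to the constant loop through loops with the same base point.
\<close>

definition simply_connected_space :: "'a topology \<Rightarrow> bool" where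
  "simply_connected_space X \<longleftrightarrow>
     path_connected_space X \<and>
     (\<forall>g a. pathin X g \<and> g 0 = a \<and> g 1 = a \<longrightarrow>
        homotopic_with (\<lambda>h. h 0 = a \<and> h 1 = a) (top_of_set {0..1}) X g (\<lambda>_. a))"


section \<open>Systolic complexes\<close>

text \<open>
  The set \<^term>\<open>A\<close> may be infinite, so a flag complex has no infinite set of pairwise
  adjacent vertices.
\<close>

definition flag :: "'a set set \<Rightarrow> bool" where
  "flag K \<longleftrightarrow>
     (\<forall>A. A \<subseteq> vertices K \<and> A \<noteq> {} \<and> (\<forall>u\<in>A. \<forall>w\<in>A. u \<noteq> w \<longrightarrow> {u, w} \<in> K) \<longrightarrow> A \<in> K)"

definition cycle_in :: "'a set set \<Rightarrow> 'a set set \<Rightarrow> bool" where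
  "cycle_in K C \<longleftrightarrow>
     subcomplex C K \<and> realization C homeomorphic_space top_of_set (sphere (0::complex) 1)"

definition cycle_length :: "'a set set \<Rightarrow> nat" where
  "cycle_length C = card (edges C)"

text \<open>Two distinct vertices of a cycle are consecutive iff they span an edge of the cycle.\<close>

definition has_diagonal :: "'a set set \<Rightarrow> 'a set set \<Rightarrow> bool" where
  "has_diagonal K C \<longleftrightarrow>
     (\<exists>u\<in>vertices C. \<exists>w\<in>vertices C. u \<noteq> w \<and> {u, w} \<notin> edges C \<and> {u, w} \<in> edges K)"

text \<open>The next three notions are meant for \<^term>\<open>4 \<le> (k::nat)\<close>.\<close>

definition k_large :: "nat \<Rightarrow> 'a set set \<Rightarrow> bool" where
  "k_large k K \<longleftrightarrow>
     flag K \<and>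
     (\<forall>C. cycle_in K C \<and> 4 \<le> cycle_length C \<and> cycle_length C < k \<longrightarrow> has_diagonal K C)"

definition locally_k_large :: "nat \<Rightarrow> 'a set set \<Rightarrow> bool" where
  "locally_k_large k K \<longleftrightarrow> (\<forall>v\<in>vertices K. k_large k (cx_link K v))"

definition k_systolic :: "nat \<Rightarrow> 'a set set \<Rightarrow> bool" where
  "k_systolic k K \<longleftrightarrow>
     simp_complex K \<and> locally_k_large k K \<and>
     connected_space (realization K) \<and> simply_connected_space (realization K)"

abbreviation systolic :: "'a set set \<Rightarrow> bool" where
  "systolic \<equiv> k_systolic 6"


section \<open>Combinatorial distance and spheres\<close>

definition edge_rel :: "'a set set \<Rightarrow> ('a \<times> 'a) set" where
  "edge_rel K = {(u, w). u \<noteq> w \<and> {u, w} \<in> K}"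

text \<open>The value is \<^term>\<open>\<infinity>::enat\<close> if there is no edge path between the two vertices.\<close>

definition edge_dist :: "'a set set \<Rightarrow> 'a \<Rightarrow> 'a \<Rightarrow> enat" where
  "edge_dist K u w = (INF m\<in>{m. (u, w) \<in> edge_rel K ^^ m}. enat m)"

definition cx_sphere :: "'a set set \<Rightarrow> 'a \<Rightarrow> nat \<Rightarrow> 'a set set" where
  "cx_sphere K v0 n = cx_span K {v \<in> vertices K. edge_dist K v v0 = enat n}"

end

theory Submission
  imports Defs "HOL-Library.FSet"
begin

text \<open>
  A complex all of whose links are 6-large is unfolded from \<open>v0\<close> level by level: a vertex of
  level \<open>n + 1\<close> is a label \<open>z\<close> together with the set of all level \<open>n\<close> vertices below it, which is
  the set generated by one level \<open>n\<close> vertex \<open>w\<close> whose star does not yet contain a vertex labelled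
  \<open>z\<close>. Fullness of 4- and 5-cycles in links shows that this set is a clique independent of the
  choice of \<open>w\<close>, so that every star of the unfolding is mapped isomorphically to a star of the
  complex. The unfolding is thus a connected covering. A null-homotopy of a closed edge walk, cut
  into squares each mapped into an open star, moves the lift of that walk to a constant one without
  changing its end point; hence in the simply connected case the covering is injective, and the
  levels are the spheres around \<open>v0\<close>. In the unfolding the projection is the intersection of the
  sets below the vertices of the simplex. It is a clique, and it is non-empty because a vertex that
  lies below the largest possible number of vertices of the simplex lies below all of them: otherwise
  some link contains a 4-cycle whose diagonals provide a better choice.
\<close>

lemma simp_complex_face: "simp_complex K \<Longrightarrow> s \<in> K \<Longrightarrow> t \<subseteq> s \<Longrightarrow> t \<noteq> {} \<Longrightarrow> t \<in> K"
  unfolding simp_complex_def by blast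

text \<open>Distinctness is part of \<open>tri\<close> and \<open>edg\<close>, so
  \<open>tri K v a b\<close> is exactly an edge between \<open>a\<close> and \<open>b\<close> in the
  link of \<open>v\<close>; links are handled below only in this form.\<close>

definition tri :: "'a set set \<Rightarrow> 'a \<Rightarrow> 'a \<Rightarrow> 'a \<Rightarrow> bool" where
  "tri K a b c \<longleftrightarrow> {a, b, c} \<in> K \<and> a \<noteq> b \<and> b \<noteq> c \<and> a \<noteq> c"

definition edg :: "'a set set \<Rightarrow> 'a \<Rightarrow> 'a \<Rightarrow> bool" where
  "edg K a b \<longleftrightarrow> {a, b} \<in> K \<and> a \<noteq> b"

lemma tri_perm:
  "tri K a b c \<Longrightarrow> tri K b a c" "tri K a b c \<Longrightarrow> tri K a c b" "tri K a b c \<Longrightarrow> tri K b c a"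
  "tri K a b c \<Longrightarrow> tri K c a b" "tri K a b c \<Longrightarrow> tri K c b a"
  by (auto simp: tri_def insert_commute)

lemma edg_sym: "edg K a b \<Longrightarrow> edg K b a"
  by (auto simp: edg_def insert_commute)

section \<open>Topology of geometric realizations\<close>

lemma open_vimage_coordinate: "open W \<Longrightarrow> open ((\<lambda>f. f i) -` W)"
  by (intro open_vimage continuous_on_product_coordinates)

text \<open>Two distinct functions differ in a coordinate, where the separating open sets are pulled
  back from. The aim is the Hausdorff instance: \<open>homeomorphic_simple_path_image_circle\<close>
  asks for it in the space containing the path, here the space of barycentric coordinates.\<close>

instance "fun" :: (type, t0_space) t0_space
proof
  fix x y :: "'a \<Rightarrow> 'b"
  assume "x \<noteq> y"
  then obtain i U where "open U" "x i \<in> U \<longleftrightarrow> y i \<notin> U"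
    using separation_t0 by (metis ext)
  then show "\<exists>U. open U \<and> \<not> (x \<in> U \<longleftrightarrow> y \<in> U)"
    by (intro exI[of _ "(\<lambda>f. f i) -` U"]) (auto simp: open_vimage_coordinate)
qed

instance "fun" :: (type, t1_space) t1_space
proof
  fix x y :: "'a \<Rightarrow> 'b"
  assume "x \<noteq> y"
  then obtain i U where "open U" "x i \<in> U" "y i \<notin> U"
    using separation_t1 by (metis ext)
  then show "\<exists>U. open U \<and> x \<in> U \<and> y \<notin> U"
    by (intro exI[of _ "(\<lambda>f. f i) -` U"]) (auto simp: open_vimage_coordinate)
qed

instance "fun" :: (type, t2_space) t2_space
proof
  fix x y :: "'a \<Rightarrow> 'b"
  assume "x \<noteq> y"
  then obtain i where "x i \<noteq> y i"
    by blast
  then obtain U V where "open U" "open V" "x i \<in> U" "y i \<in> V" "U \<inter> V = {}"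
    using hausdorff by metis
  then show "\<exists>U V. open U \<and> open V \<and> x \<in> U \<and> y \<in> V \<and> U \<inter> V = {}"
    by (intro exI[of _ "(\<lambda>f. f i) -` U"] exI[of _ "(\<lambda>f. f i) -` V"])
       (auto simp: open_vimage_coordinate)
qed

lemma continuous_map_simplex_realization:
  assumes "s \<in> K" "continuous_on S f" "f ` S \<subseteq> geom_simplex s"
  shows "continuous_map (top_of_set S) (realization K) f"
proof -
  have id: "continuous_map (top_of_set (geom_simplex s)) (realization K) id"
  proof (rule continuous_map_openin_preimage_eq[THEN iffD2], intro conjI allI impI)
    show "id \<in> topspace (top_of_set (geom_simplex s)) \<rightarrow> topspace (realization K)"
      using assms(1) by (auto simp: topspace_realization)
    show "openin (top_of_set (geom_simplex s)) (topspace (top_of_set (geom_simplex s)) \<inter> id -` U)"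
      if "openin (realization K) U" for U
      using that assms(1) by (simp add: openin_realization Int_commute)
  qed
  have "continuous_map (top_of_set S) (top_of_set (geom_simplex s)) f"
    using assms(2,3) by (simp add: image_subset_iff_funcset)
  from continuous_map_compose[OF this id] show ?thesis
    by simp
qed

lemma closed_geom_simplex: "closed (geom_simplex s)"
proof -
  have eq: "geom_simplex s = (\<Inter>v. {x. 0 \<le> x v}) \<inter> (\<Inter>v \<in> -s. {x. x v = 0}) \<inter> {x. (\<Sum>v\<in>s. x v) = 1}"
    by (auto simp: geom_simplex_def)
  show ?thesis
    unfolding eq
    by (intro closed_Int closed_INT ballI closed_Collect_le closed_Collect_eq continuous_intros
          continuous_on_product_coordinates)
qed

text \<open>Every simplex is closed, and a finite union of closed sets is closed, so closedness may
  be tested simplex by simplex. For cycles this replaces the weak topology by the subspace topology,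
  to which the results on simple paths apply.\<close>

lemma realization_finite:
  assumes "finite K"
  shows "realization K = top_of_set (\<Union>s\<in>K. geom_simplex s)" (is "_ = top_of_set ?R")
proof (rule topology_eq[THEN iffD2], intro allI iffI)
  fix U
  assume U: "openin (realization K) U"
  then have sub: "U \<subseteq> ?R" and op: "\<And>s. s \<in> K \<Longrightarrow> openin (top_of_set (geom_simplex s)) (U \<inter> geom_simplex s)"
    by (auto simp: openin_realization)
  have "closedin (top_of_set ?R) (geom_simplex s - U)" if "s \<in> K" for s
  proof -
    have "closedin (top_of_set (geom_simplex s)) (geom_simplex s - U \<inter> geom_simplex s)"
      using op[OF that] by (simp add: closedin_def double_diff)
    then have "closed (geom_simplex s - U)"
      using closedin_closed_trans[OF _ closed_geom_simplex] by (metis Diff_Int2 Diff_Int_distrib inf.idem Diff_Compl Int_commute)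
    then show ?thesis
      using that by (intro closed_subset) auto
  qed
  then have "closedin (top_of_set ?R) (\<Union>s\<in>K. geom_simplex s - U)"
    using assms by (intro closedin_Union) auto
  moreover have "(\<Union>s\<in>K. geom_simplex s - U) = ?R - U"
    by auto
  ultimately show "openin (top_of_set ?R) U"
    using sub by (subst openin_closedin_eq) simp
next
  fix U
  assume U: "openin (top_of_set ?R) U"
  then obtain T where T: "open T" "U = ?R \<inter> T"
    by (auto simp: openin_open)
  have "openin (top_of_set (geom_simplex s)) (U \<inter> geom_simplex s)" if "s \<in> K" for s
    unfolding openin_open using that T by (intro exI[of _ T]) auto
  then show "openin (realization K) U"
    using openin_subset[OF U] by (simp add: openin_realization)
qed

lemma homeomorphic_imp_homeomorphic_space:
  assumes "S homeomorphic T"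
  shows "top_of_set S homeomorphic_space top_of_set T"
proof -
  obtain f g where "homeomorphism S T f g"
    using assms by (auto simp: homeomorphic_def)
  then have "homeomorphic_maps (top_of_set S) (top_of_set T) f g"
    by (auto simp: homeomorphism_def homeomorphic_maps_def)
  then show ?thesis
    by (auto simp: homeomorphic_space_def)
qed

section \<open>Edge walks as parametrized paths\<close>

definition seg :: "(nat \<Rightarrow> 'a) \<Rightarrow> nat \<Rightarrow> real \<Rightarrow> 'a \<Rightarrow> real" where
  "seg u k s v = (if u k = v then 1 + real k - s else 0) + (if u (Suc k) = v then s - real k else 0)"

text \<open>The piecewise affine path that is at \<open>u k\<close> at time \<open>k\<close>. The
  two summands of \<open>seg\<close> add up when \<open>u k = u (Suc k)\<close>, so a repeated
  vertex gives a constant piece.\<close>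

definition walk :: "(nat \<Rightarrow> 'a) \<Rightarrow> real \<Rightarrow> 'a \<Rightarrow> real" where
  "walk u s = seg u (nat \<lfloor>s\<rfloor>) s"

lemma walk_eq_seg:
  assumes "real k \<le> s" "s \<le> real (Suc k)"
  shows "walk u s = seg u k s"
proof (cases "s = real (Suc k)")
  case True
  then have "nat \<lfloor>s\<rfloor> = Suc k"
    by linarith
  then show ?thesis
    using True by (auto simp: walk_def seg_def fun_eq_iff)
next
  case False
  then have "nat \<lfloor>s\<rfloor> = k"
    using assms by linarith
  then show ?thesis
    by (simp add: walk_def)
qed

lemma walk_nat: "walk u (real k) v = (if v = u k then 1 else 0)"
  by (auto simp: walk_def seg_def)

lemma walk_support:
  assumes "real k \<le> s" "s \<le> real (Suc k)" "walk u s v > 0"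
  shows "v \<in> {u k, u (Suc k)}"
  using assms by (auto simp: walk_eq_seg seg_def split: if_splits)

lemma seg_in_simplex:
  assumes "real k \<le> s" "s \<le> real (Suc k)"
  shows "seg u k s \<in> geom_simplex {u k, u (Suc k)}"
  using assms by (cases "u k = u (Suc k)") (auto simp: geom_simplex_def seg_def)

lemma continuous_on_seg: "continuous_on S (seg u k)"
proof (rule continuous_on_coordinatewise_then_product)
  show "continuous_on S (\<lambda>s. seg u k s v)" for v
    by (cases "u k = v"; cases "u (Suc k) = v") (auto simp: seg_def intro!: continuous_intros)
qed

text \<open>The target is kept general because the lemma is needed both for the Euclidean topology
  (cycles) and for the weak topology (paths in an arbitrary complex).\<close>

lemma walk_pasting:
  assumes "\<And>k. k < m \<Longrightarrow> continuous_map (top_of_set {real k..real (Suc k)}) Y (seg u k)" and "m > 0"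
  shows "continuous_map (top_of_set {0..real m}) Y (walk u)"
proof (rule pasting_lemma_closed[where I = "{..<m}" and T = "\<lambda>k. {real k..real (Suc k)}" and f = "seg u"])
  show "closedin (top_of_set {0..real m}) {real k..real (Suc k)}" if "k \<in> {..<m}" for k
    using that by (intro closed_subset) auto
  show "continuous_map (subtopology (top_of_set {0..real m}) {real k..real (Suc k)}) Y (seg u k)"
    if "k \<in> {..<m}" for k
  proof -
    have "{0..real m} \<inter> {real k..real (Suc k)} = {real k..real (Suc k)}"
      using that by auto
    then show ?thesis
      using assms that by (simp add: subtopology_subtopology del: of_nat_Suc)
  qed
  show "seg u i s = seg u j s"
    if "s \<in> topspace (top_of_set {0..real m}) \<inter> {real i..real (Suc i)} \<inter> {real j..real (Suc j)}" for i j s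
    using that walk_eq_seg[of i s u] walk_eq_seg[of j s u] by (auto simp del: of_nat_Suc)
  show "\<exists>j. j \<in> {..<m} \<and> s \<in> {real j..real (Suc j)} \<and> walk u s = seg u j s"
    if s: "s \<in> topspace (top_of_set {0..real m})" for s
  proof (cases "s = real m")
    \<comment> \<open>At the right end the floor selects the segment \<open>m\<close>, which lies
      outside the index set; the segment \<open>m - 1\<close> has the same value there.\<close>
    case True
    with \<open>m > 0\<close> show ?thesis
      by (intro exI[of _ "m - 1"] conjI walk_eq_seg) auto
  next
    case False
    with s show ?thesis
      by (intro exI[of _ "nat \<lfloor>s\<rfloor>"] conjI walk_eq_seg) (auto, linarith+)
  qed
qed auto

lemma continuous_on_walk: "m > 0 \<Longrightarrow> continuous_on {0..real m} (walk u)"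
  using walk_pasting[of m euclidean u] by (simp add: continuous_on_seg)

lemma continuous_map_walk:
  assumes "\<And>k. k < m \<Longrightarrow> {u k, u (Suc k)} \<in> K" and "m > 0"
  shows "continuous_map (top_of_set {0..real m}) (realization K) (walk u)"
  using assms seg_in_simplex
  by (intro walk_pasting continuous_map_simplex_realization continuous_on_seg) (auto simp del: of_nat_Suc)

lemma pathin_walk:
  assumes "\<And>k. k < m \<Longrightarrow> {u k, u (Suc k)} \<in> K" and "m > 0"
  shows "pathin (realization K) (\<lambda>t. walk u (real m * t))"
proof -
  have "continuous_map (top_of_set {0..1}) (top_of_set {0..real m}) (\<lambda>t. real m * t)"
    by (auto intro!: continuous_intros simp: mult_left_le)
  moreover have "continuous_map (top_of_set {0..real m}) (realization K) (walk u)"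
    using assms by (intro continuous_map_walk)
  ultimately have "continuous_map (top_of_set {0..1}) (realization K) (walk u \<circ> (\<lambda>t. real m * t))"
    by (rule continuous_map_compose)
  then show ?thesis
    by (simp add: pathin_def o_def)
qed

text \<open>A set of vertices closed under adjacency contains each simplex entirely or misses it
  entirely, so it and its complement split the realization into two disjoint open sets.\<close>

lemma connected_space_vertices:
  assumes K: "simp_complex K" and conn: "connected_space (realization K)"
    and A: "v \<in> A" "v \<in> vertices K" "\<And>a b. a \<in> A \<Longrightarrow> edg K a b \<Longrightarrow> b \<in> A"
    and w: "w \<in> vertices K"
  shows "w \<in> A"
proof (rule ccontr)
  assume "w \<notin> A"
  \<comment> \<open>The closed simplices with all vertices in \<open>B\<close>. In the weak topology
    this union is open as soon as every simplex lies inside \<open>B\<close> or inside its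
    complement, since it then meets each simplex in everything or nothing.\<close>
  define U where "U = (\<lambda>B. \<Union>s\<in>{s \<in> K. s \<subseteq> B}. geom_simplex s)"
  have split: "s \<subseteq> A \<or> s \<subseteq> - A" if s: "s \<in> K" for s
  proof -
    have "edg K a b" if "a \<in> s" "b \<in> s" "a \<noteq> b" for a b
      using simp_complex_face[OF K s, of "{a, b}"] that by (auto simp: edg_def)
    then show ?thesis
      using A(3) by blast
  qed
  have disj: "geom_simplex s \<inter> geom_simplex t = {}" if "s \<inter> t = {}" for s t :: "'a set"
  proof -
    have False if p: "p \<in> geom_simplex s" "p \<in> geom_simplex t" for p
    proof -
      have "p u = 0" if "u \<in> s" for u
        using p(2) that \<open>s \<inter> t = {}\<close> by (auto simp: geom_simplex_def)
      then show False
        using p(1) by (simp add: geom_simplex_def)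
    qed
    then show ?thesis by blast
  qed
  have op: "openin (realization K) (U B)" if B: "\<And>s. s \<in> K \<Longrightarrow> s \<subseteq> B \<or> s \<subseteq> - B" for B
    unfolding openin_realization
  proof (intro conjI ballI)
    fix s assume s: "s \<in> K"
    show "openin (top_of_set (geom_simplex s)) (U B \<inter> geom_simplex s)"
    proof (cases "s \<subseteq> B")
      case True
      then have "U B \<inter> geom_simplex s = geom_simplex s"
        using s by (auto simp: U_def)
      then show ?thesis by simp
    next
      case False
      then have "s \<subseteq> - B" using B s by blast
      then have "geom_simplex t \<inter> geom_simplex s = {}" if "t \<subseteq> B" for t
        using that by (intro disj) blast
      then have "U B \<inter> geom_simplex s = {}"
        by (auto simp: U_def)
      then show ?thesis by simp
    qed
  qed (auto simp: U_def)
  have pt: "\<exists>p. p \<in> U B" if "x \<in> vertices K" "x \<in> B" for x B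
  proof -
    have "{x} \<in> K"
      using that(1) simp_complex_face[OF K, of _ "{x}"] by (auto simp: vertices_def)
    moreover have "(\<lambda>y. if y = x then 1 else 0) \<in> geom_simplex {x}"
      by (auto simp: geom_simplex_def)
    ultimately show ?thesis
      using that(2) unfolding U_def by blast
  qed
  have "U A \<inter> U (- A) = {}"
  proof -
    have "geom_simplex s \<inter> geom_simplex t = {}" if "s \<subseteq> A" "t \<subseteq> - A" for s t
      by (rule disj) (use that in blast)
    then show ?thesis unfolding U_def by blast
  qed
  moreover have "topspace (realization K) \<subseteq> U A \<union> U (- A)"
    using split unfolding topspace_realization U_def by blast
  moreover have "openin (realization K) (U A)" "openin (realization K) (U (- A))"
    using split by (auto intro!: op)
  moreover have "U A \<noteq> {}" "U (- A) \<noteq> {}"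
    using pt[of v A] pt[of w "- A"] A w \<open>w \<notin> A\<close> by auto
  ultimately show False
    using conn unfolding connected_space_def by blast
qed

section \<open>Cycles in links\<close>

definition cycle_cx :: "nat \<Rightarrow> (nat \<Rightarrow> 'a) \<Rightarrow> 'a set set" where
  "cycle_cx m u = (\<lambda>k. {u k}) ` {..<m} \<union> (\<lambda>k. {u k, u (Suc k)}) ` {..<m}"

context
  fixes m :: nat and u :: "nat \<Rightarrow> 'a"
  assumes m: "m \<ge> 3" and loop: "u m = u 0" and inj: "inj_on u {..<m}"
begin

text \<open>The only repetition among the indices up to \<open>m\<close> is the closing one. All
  later case distinctions on coinciding vertices go through this.\<close>

lemma cycle_index_eq:
  assumes "i \<le> m" "j \<le> m" "u i = u j"
  shows "i = j \<or> i = 0 \<and> j = m \<or> i = m \<and> j = 0"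
proof -
  have "i' = j'" if "i' < m" "j' < m" "u i' = u j'" for i' j'
    using that inj by (auto simp: inj_on_def)
  then show ?thesis
    using assms loop m by (metis le_neq_implies_less less_le_trans zero_less_numeral)
qed

lemma cycle_consecutive: "k < m \<Longrightarrow> u k \<noteq> u (Suc k)"
  using cycle_index_eq[of k "Suc k"] m by auto

lemma walk_image: "walk u ` {0..real m} = (\<Union>s\<in>cycle_cx m u. geom_simplex s)"
proof (intro subset_antisym subsetI)
  fix x assume "x \<in> walk u ` {0..real m}"
  then obtain s where s: "0 \<le> s" "s \<le> real m" "x = walk u s"
    by auto
  show "x \<in> (\<Union>s\<in>cycle_cx m u. geom_simplex s)"
  proof (cases "s = real m")
    case True
    then have "x \<in> geom_simplex {u 0}"
      using s by (auto simp: geom_simplex_def walk_nat loop)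
    then show ?thesis
      using m by (auto simp: cycle_cx_def)
  next
    case False
    define k where "k = nat \<lfloor>s\<rfloor>"
    have k: "real k \<le> s" "s \<le> real (Suc k)" "k < m"
      using s False unfolding k_def by linarith+
    then have "x \<in> geom_simplex {u k, u (Suc k)}"
      using s seg_in_simplex walk_eq_seg by metis
    then show ?thesis
      using k by (auto simp: cycle_cx_def)
  qed
next
  fix x assume "x \<in> (\<Union>s\<in>cycle_cx m u. geom_simplex s)"
  then consider k where "k < m" "x \<in> geom_simplex {u k}" | k where "k < m" "x \<in> geom_simplex {u k, u (Suc k)}"
    by (auto simp: cycle_cx_def)
  then show "x \<in> walk u ` {0..real m}"
  proof cases
    case 1
    then have "x = walk u (real k)"
      by (auto simp: geom_simplex_def walk_nat fun_eq_iff)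
    then show ?thesis
      using 1 by auto
  next
    case 2
    have sum: "x (u k) + x (u (Suc k)) = 1" and nn: "x (u k) \<ge> 0" "x (u (Suc k)) \<ge> 0"
      and z: "\<And>v. v \<noteq> u k \<Longrightarrow> v \<noteq> u (Suc k) \<Longrightarrow> x v = 0"
      using 2 cycle_consecutive[of k] by (auto simp: geom_simplex_def)
    define s where "s = real k + x (u (Suc k))"
    have s: "real k \<le> s" "s \<le> real (Suc k)"
      using sum nn by (auto simp: s_def)
    have "x = seg u k s"
      using sum z cycle_consecutive[OF 2(1)] by (auto simp: seg_def s_def fun_eq_iff)
    then have "x = walk u s"
      by (simp add: walk_eq_seg[OF s])
    moreover have "s \<in> {0..real m}"
      using s 2(1) by auto
    ultimately show ?thesis
      by blast
  qed
qed

text \<open>On a half-open segment the initial vertex has positive weight. Equal points therefore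
  have segments \<open>k\<close> and \<open>l\<close> each containing the initial vertex of the
  other, and for \<open>m \<ge> 3\<close> this forces \<open>k = l\<close>; inside one segment the
  weights determine the parameter.\<close>

lemma walk_inj:
  assumes "0 \<le> s" "s < real m" "0 \<le> t" "t < real m" "walk u s = walk u t"
  shows "s = t"
proof -
  define k where "k = nat \<lfloor>s\<rfloor>"
  define l where "l = nat \<lfloor>t\<rfloor>"
  have k: "real k \<le> s" "s < real (Suc k)" "k < m" and l: "real l \<le> t" "t < real (Suc l)" "l < m"
    using assms unfolding k_def l_def by linarith+
  have eq: "seg u k s = seg u l t"
    using assms walk_eq_seg[of k s u] walk_eq_seg[of l t u] k l by simp
  have pos: "seg u k s (u k) > 0" "seg u l t (u l) > 0"
    using k l by (auto simp: seg_def)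
  then have "seg u l t (u k) > 0" "seg u k s (u l) > 0"
    using eq by simp_all
  then have "u k \<in> {u l, u (Suc l)}" "u l \<in> {u k, u (Suc k)}"
    by (auto simp: seg_def split: if_splits)
  then have "k = l \<or> k = Suc l \<or> k = 0 \<and> Suc l = m" "l = k \<or> l = Suc k \<or> l = 0 \<and> Suc k = m"
    using k(3) l(3) cycle_index_eq[of k l] cycle_index_eq[of k "Suc l"] cycle_index_eq[of l "Suc k"]
    by (metis Suc_leI insertE less_imp_le less_irrefl singletonD)+
  then have "k = l"
    using m by linarith
  then have "seg u k s (u k) = seg u k t (u k)"
    using eq by simp
  then show ?thesis
    using cycle_consecutive[OF k(3)] by (auto simp: seg_def)
qed

lemma realization_cycle_cx: "realization (cycle_cx m u) homeomorphic_space top_of_set (sphere (0::complex) 1)"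
proof -
  let ?g = "\<lambda>t. walk u (real m * t)"
  have img: "(\<lambda>t. real m * t) ` {0..1} = {0..real m}"
    using m by (subst image_mult_atLeastAtMost) auto
  have "continuous_on ((\<lambda>t. real m * t) ` {0..1}) (walk u)"
    unfolding img using m by (intro continuous_on_walk) auto
  then have "path ?g"
    unfolding path_def by (intro continuous_on_compose2[of _ "walk u" _ "\<lambda>t. real m * t"]) (auto intro!: continuous_intros)
  have ends: "?g 1 = ?g 0"
    using walk_nat[of u m] walk_nat[of u 0] loop by (simp add: fun_eq_iff)
  have "loop_free ?g"
    unfolding loop_free_def
  proof (intro ballI impI)
    fix s t :: real assume st: "s \<in> {0..1}" "t \<in> {0..1}" "?g s = ?g t"
    have *: "a = b" if "a \<in> {0..<1}" "b \<in> {0..<1}" "?g a = ?g b" for a b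
      using that walk_inj[of "real m * a" "real m * b"] m by auto
    show "s = t \<or> s = 0 \<and> t = 1 \<or> s = 1 \<and> t = 0"
      using *[of s t] *[of s 0] *[of 0 t] st ends by (cases "s = 1"; cases "t = 1") auto
  qed
  then have "simple_path ?g"
    using \<open>path ?g\<close> by (simp add: simple_path_def)
  then have "path_image ?g homeomorphic sphere (0::complex) 1"
    using ends by (intro homeomorphic_simple_path_image_circle) (auto simp: pathstart_def pathfinish_def)
  moreover have "path_image ?g = (\<Union>s\<in>cycle_cx m u. geom_simplex s)"
    unfolding path_image_def walk_image[symmetric] img[symmetric] by (simp add: image_image)
  moreover have "finite (cycle_cx m u)"
    by (simp add: cycle_cx_def)
  ultimately show ?thesis
    by (simp add: realization_finite homeomorphic_imp_homeomorphic_space)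
qed

lemma edges_cycle_cx: "edges (cycle_cx m u) = (\<lambda>k. {u k, u (Suc k)}) ` {..<m}"
  using cycle_consecutive by (auto simp: edges_def cycle_cx_def card_2_iff)

text \<open>Two indices could give the same edge only by traversing it in opposite directions, which
  needs a closed walk of length two.\<close>

lemma cycle_length_cycle_cx: "cycle_length (cycle_cx m u) = m"
proof -
  have "inj_on (\<lambda>k. {u k, u (Suc k)}) {..<m}"
  proof (rule inj_onI)
    fix i j assume ij: "i \<in> {..<m}" "j \<in> {..<m}" and "{u i, u (Suc i)} = {u j, u (Suc j)}"
    then consider "u i = u j" | "u i = u (Suc j)" "u (Suc i) = u j"
      by (auto simp: doubleton_eq_iff)
    then show "i = j"
    proof cases
      case 1
      then show ?thesis using cycle_index_eq[of i j] ij by simp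
    next
      case 2
      then have "i = Suc j \<or> i = 0 \<and> Suc j = m" "Suc i = j \<or> Suc i = m \<and> j = 0"
        using cycle_index_eq[of i "Suc j"] cycle_index_eq[of "Suc i" j] ij by simp_all
      then show ?thesis using m by linarith
    qed
  qed
  then show ?thesis
    unfolding cycle_length_def edges_cycle_cx by (simp add: card_image)
qed

lemma simp_complex_cycle_cx: "simp_complex (cycle_cx m u)"
proof -
  have v: "{u (Suc k)} \<in> cycle_cx m u" if "k < m" for k
  proof (cases "Suc k = m")
    case True
    then show ?thesis using loop m by (auto simp: cycle_cx_def)
  next
    case False
    then show ?thesis using that by (auto simp: cycle_cx_def)
  qed
  have "t \<in> cycle_cx m u" if st: "s \<in> cycle_cx m u" "t \<subseteq> s" "t \<noteq> {}" for s t
  proof -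
    consider k where "k < m" "s = {u k}" | k where "k < m" "s = {u k, u (Suc k)}"
      using st(1) by (auto simp: cycle_cx_def)
    then show ?thesis
    proof cases
      case 1
      then have "t = s" using st by blast
      then show ?thesis using st by simp
    next
      case 2
      then have "t = {u k} \<or> t = {u (Suc k)} \<or> t = s" using st(2,3) by blast
      moreover have "{u k} \<in> cycle_cx m u" using 2 by (auto simp: cycle_cx_def)
      ultimately show ?thesis using v[OF 2(1)] st(1) by auto
    qed
  qed
  moreover have "finite s \<and> s \<noteq> {}" if "s \<in> cycle_cx m u" for s
    using that by (auto simp: cycle_cx_def)
  ultimately show ?thesis
    unfolding simp_complex_def by blast
qed

lemma vertices_cycle_cx: "vertices (cycle_cx m u) = u ` {..<m}"
proof -
  have "u (Suc k) \<in> u ` {..<m}" if "k < m" for k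
    using that m loop by (cases "Suc k = m") auto
  then show ?thesis
    unfolding vertices_def cycle_cx_def by auto
qed

text \<open>Passes from cycles defined by a homeomorphism to closed sequences of vertices: such a
  sequence spans a subcomplex homeomorphic to the circle and of length \<open>m\<close>, to which
  largeness applies.\<close>

lemma k_large_diagonal:
  assumes "k_large n K" "simp_complex K" "4 \<le> m" "m < n" and e: "\<And>k. k < m \<Longrightarrow> {u k, u (Suc k)} \<in> K"
  shows "\<exists>i<m. \<exists>j<m. u i \<noteq> u j \<and> {u i, u j} \<in> K \<and> (\<forall>k<m. {u i, u j} \<noteq> {u k, u (Suc k)})"
proof -
  have "{u k} \<in> K" if "k < m" for k
    using e[OF that] by (rule simp_complex_face[OF assms(2)]) auto
  then have "cycle_in K (cycle_cx m u)"
    using e simp_complex_cycle_cx realization_cycle_cx by (auto simp: cycle_in_def subcomplex_def cycle_cx_def)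
  then have "has_diagonal K (cycle_cx m u)"
    using assms by (simp add: k_large_def cycle_length_cycle_cx)
  then show ?thesis
    unfolding has_diagonal_def vertices_cycle_cx edges_cycle_cx by (auto simp: edges_def)
qed

end

section \<open>Short cycles in the link of a vertex\<close>

lemma simp_complex_link:
  assumes "simp_complex K" shows "simp_complex (cx_link K v)"
  unfolding simp_complex_def
proof (intro conjI ballI allI impI)
  fix s assume s: "s \<in> cx_link K v"
  then show "finite s" "s \<noteq> {}"
    using assms by (auto simp: cx_link_def simp_complex_def)
  fix t assume t: "t \<subseteq> s \<and> t \<noteq> {}"
  have "t \<in> K"
    using s t simp_complex_face[OF assms, of s t] by (simp add: cx_link_def)
  moreover have "insert v t \<in> K"
    using s t simp_complex_face[OF assms, of "insert v s" "insert v t"] by (auto simp: cx_link_def)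
  ultimately show "t \<in> cx_link K v"
    using s t by (auto simp: cx_link_def)
qed

lemma edge_in_link_iff_tri:
  assumes "simp_complex K" "a \<noteq> b"
  shows "{a, b} \<in> cx_link K v \<longleftrightarrow> tri K v a b"
proof -
  have "{a, b} \<in> K" if "{v, a, b} \<in> K"
    by (rule simp_complex_face[OF assms(1) that]) auto
  then show ?thesis
    using assms(2) by (auto simp: cx_link_def tri_def)
qed

text \<open>The sequence \<open>u\<close> repeats \<open>a\<close> at index 4 to close up. A
  diagonal joins two of the four vertices but is none of the four sides, which leaves only the two
  opposite pairs.\<close>

lemma link_4_cycle_diagonal:
  assumes K: "simp_complex K" and large: "k_large 6 (cx_link K v)"
    and t: "tri K v a b" "tri K v b c" "tri K v c d" "tri K v d a" and ne: "a \<noteq> c" "b \<noteq> d"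
  shows "tri K v a c \<or> tri K v b d"
proof -
  define u where "u = (\<lambda>i. [a, b, c, d, a] ! i)"
  have ne': "a \<noteq> b" "b \<noteq> c" "c \<noteq> d" "d \<noteq> a"
    using t by (auto simp: tri_def)
  have u: "u 0 = a" "u (Suc 0) = b" "u (Suc (Suc 0)) = c" "u (Suc (Suc (Suc 0))) = d" "u (Suc (Suc (Suc (Suc 0)))) = a"
    by (simp_all add: u_def)
  have "\<exists>i<4. \<exists>j<4. u i \<noteq> u j \<and> {u i, u j} \<in> cx_link K v \<and> (\<forall>k<4. {u i, u j} \<noteq> {u k, u (Suc k)})"
  proof (rule k_large_diagonal[OF _ _ _ large simp_complex_link[OF K]])
    show "inj_on u {..<4}"
      using ne ne' by (auto simp: inj_on_def numeral_eq_Suc less_Suc_eq u)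
    show "{u k, u (Suc k)} \<in> cx_link K v" if "k < 4" for k
      using that t ne' by (auto simp: numeral_eq_Suc less_Suc_eq u edge_in_link_iff_tri[OF K])
  qed (simp_all add: u numeral_eq_Suc)
  then obtain i j where ij: "i < 4" "j < 4" "u i \<noteq> u j" "tri K v (u i) (u j)" "\<forall>k<4. {u i, u j} \<noteq> {u k, u (Suc k)}"
    using edge_in_link_iff_tri[OF K] by blast
  then have "tri K v a c \<or> tri K v c a \<or> tri K v b d \<or> tri K v d b"
  proof -
    let ?I = "{0, Suc 0, Suc (Suc 0), Suc (Suc (Suc 0))}"
    have "i \<in> ?I" "j \<in> ?I"
      using ij(1,2) by auto
    moreover have "{u i, u j} \<noteq> {a, b}" "{u i, u j} \<noteq> {b, c}" "{u i, u j} \<noteq> {c, d}" "{u i, u j} \<noteq> {d, a}"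
      using ij(5) by (simp_all add: numeral_eq_Suc All_less_Suc u)
    ultimately show ?thesis
      using ij(3,4) unfolding insert_iff empty_iff by (elim disjE) (simp_all add: u insert_commute)
  qed
  then show ?thesis
    by (metis tri_perm(2))
qed

lemma link_5_cycle_diagonal:
  assumes K: "simp_complex K" and large: "k_large 6 (cx_link K v)"
    and t: "tri K v a b" "tri K v b c" "tri K v c d" "tri K v d e" "tri K v e a" and ne: "distinct [a, b, c, d, e]"
  shows "tri K v a c \<or> tri K v b d \<or> tri K v c e \<or> tri K v d a \<or> tri K v e b"
proof -
  define u where "u = (\<lambda>i. [a, b, c, d, e, a] ! i)"
  have u: "u 0 = a" "u (Suc 0) = b" "u (Suc (Suc 0)) = c" "u (Suc (Suc (Suc 0))) = d" "u (Suc (Suc (Suc (Suc 0)))) = e"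
     "u (Suc (Suc (Suc (Suc (Suc 0))))) = a"
    by (simp_all add: u_def)
  have "\<exists>i<5. \<exists>j<5. u i \<noteq> u j \<and> {u i, u j} \<in> cx_link K v \<and> (\<forall>k<5. {u i, u j} \<noteq> {u k, u (Suc k)})"
  proof (rule k_large_diagonal[OF _ _ _ large simp_complex_link[OF K]])
    show "inj_on u {..<5}"
      using ne by (auto simp: inj_on_def numeral_eq_Suc less_Suc_eq u)
    show "{u k, u (Suc k)} \<in> cx_link K v" if "k < 5" for k
      using that t ne by (auto simp: numeral_eq_Suc less_Suc_eq u edge_in_link_iff_tri[OF K])
  qed (simp_all add: u numeral_eq_Suc)
  then obtain i j where ij: "i < 5" "j < 5" "u i \<noteq> u j" "tri K v (u i) (u j)" "\<forall>k<5. {u i, u j} \<noteq> {u k, u (Suc k)}"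
    using edge_in_link_iff_tri[OF K] by blast
  then have "tri K v a c \<or> tri K v c a \<or> tri K v b d \<or> tri K v d b \<or> tri K v c e \<or> tri K v e c \<or>
      tri K v d a \<or> tri K v a d \<or> tri K v e b \<or> tri K v b e"
  proof -
    let ?I = "{0, Suc 0, Suc (Suc 0), Suc (Suc (Suc 0)), Suc (Suc (Suc (Suc 0)))}"
    have "i \<in> ?I" "j \<in> ?I"
      using ij(1,2) by auto
    moreover have "{u i, u j} \<noteq> {a, b}" "{u i, u j} \<noteq> {b, c}" "{u i, u j} \<noteq> {c, d}"
      "{u i, u j} \<noteq> {d, e}" "{u i, u j} \<noteq> {e, a}"
      using ij(5) by (simp_all add: numeral_eq_Suc All_less_Suc u)
    ultimately show ?thesis
      using ij(3,4) unfolding insert_iff empty_iff by (elim disjE) (simp_all add: u insert_commute)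
  qed
  then show ?thesis
    by (metis tri_perm(2))
qed

section \<open>Lifting closed walks\<close>

text \<open>A point lies in some closed simplex, and all vertices with positive weight belong to it.
  Hence open stars of vertices with a common point belong to vertices of one simplex.\<close>

lemma realization_support_simplex:
  assumes "simp_complex K" "p \<in> topspace (realization K)" "A \<noteq> {}" "\<And>v. v \<in> A \<Longrightarrow> p v > 0"
  shows "A \<in> K"
proof -
  obtain s where s: "s \<in> K" "p \<in> geom_simplex s"
    using assms(2) by (auto simp: topspace_realization)
  have "v \<in> s" if "v \<in> A" for v
    using s(2) assms(4)[OF that] by (force simp: geom_simplex_def)
  then show ?thesis
    using simp_complex_face[OF assms(1) s(1) _ assms(3)] by blast
qed

lemma openin_open_star: "openin (realization K) {p \<in> topspace (realization K). p v > 0}"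
  unfolding openin_realization
proof (intro conjI ballI)
  fix s assume s: "s \<in> K"
  have "open {p :: 'a \<Rightarrow> real. p v > 0}"
    by (intro open_Collect_less continuous_on_const continuous_on_product_coordinates)
  moreover have "{p \<in> topspace (realization K). p v > 0} \<inter> geom_simplex s = geom_simplex s \<inter> {p. p v > 0}"
    using s by (auto simp: topspace_realization)
  ultimately show "openin (top_of_set (geom_simplex s)) ({p \<in> topspace (realization K). p v > 0} \<inter> geom_simplex s)"
    by (auto simp: openin_open)
qed (auto simp: topspace_realization)

lemma realization_positive_coordinate:
  assumes "p \<in> topspace (realization K)"
  shows "\<exists>v. p v > 0"
proof (rule ccontr)
  assume "\<nexists>v. p v > 0"
  moreover obtain s where "p \<in> geom_simplex s"
    using assms by (auto simp: topspace_realization)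
  ultimately have "p = (\<lambda>_. 0)" "sum p s = 1"
    by (auto simp: geom_simplex_def fun_eq_iff intro: antisym not_less[THEN iffD1])
  then show False by simp
qed

text \<open>The preimages of the open stars cover the compact square, so a Lebesgue number exists; a
  grid square of side \<open>1 / N\<close> has diameter at most \<open>2 / N\<close>. The bound
  holds for all large \<open>N\<close>, so that \<open>N\<close> can later be taken to be a multiple
  of the length of a walk.\<close>

lemma grid_open_stars:
  fixes h :: "real \<times> real \<Rightarrow> 'a \<Rightarrow> real"
  assumes h: "continuous_map (top_of_set ({0..1} \<times> {0..1})) (realization K) h"
  obtains M :: nat where "M > 0"
    "\<And>N i j. M \<le> N \<Longrightarrow> i < N \<Longrightarrow> j < N \<Longrightarrow>
      \<exists>v. \<forall>s t. real i \<le> s * real N \<and> s * real N \<le> real (Suc i) \<and>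
                real j \<le> t * real N \<and> t * real N \<le> real (Suc j) \<longrightarrow> h (s, t) v > 0"
proof -
  let ?S = "{0..1} \<times> {0..1} :: (real \<times> real) set"
  have "\<exists>T. open T \<and> {p \<in> ?S. h p v > 0} = ?S \<inter> T" for v
  proof -
    have "{p \<in> ?S. h p \<in> {p \<in> topspace (realization K). p v > 0}} = {p \<in> ?S. h p v > 0}"
      using continuous_map_funspace[OF h] by auto
    then have "openin (top_of_set ?S) {p \<in> ?S. h p v > 0}"
      using openin_continuous_map_preimage[OF h openin_open_star[of K v]] by simp
    then show ?thesis
      by (simp add: openin_open)
  qed
  then obtain T where T: "\<And>v. open (T v)" "\<And>v. {p \<in> ?S. h p v > 0} = ?S \<inter> T v"
    by metis
  have cover: "?S \<subseteq> \<Union> (range T)"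
  proof
    fix p assume p: "p \<in> ?S"
    then have "h p \<in> topspace (realization K)"
      using continuous_map_funspace[OF h] by auto
    then obtain v where "h p v > 0"
      using realization_positive_coordinate by blast
    then show "p \<in> \<Union> (range T)"
      using p T(2)[of v] by blast
  qed
  have "compact ?S" "range T \<noteq> {}"
    by (auto intro: compact_Times)
  then obtain \<delta> where \<delta>: "0 < \<delta>" "\<And>A. A \<subseteq> ?S \<Longrightarrow> diameter A < \<delta> \<Longrightarrow> \<exists>B \<in> range T. A \<subseteq> B"
    using cover by (rule Lebesgue_number_lemma) (use T(1) in auto)
  obtain M :: nat where M: "2 / \<delta> < real M"
    using reals_Archimedean2 by blast
  show thesis
  proof (rule that)
    show "M > 0"
      using M \<delta>(1) by (metis divide_pos_pos gr0I less_trans of_nat_0 order_less_asym zero_less_numeral)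
    fix N i j :: nat
    assume N: "M \<le> N" "i < N" "j < N"
    let ?A = "{(s, t). real i \<le> s * real N \<and> s * real N \<le> real (Suc i) \<and>
                real j \<le> t * real N \<and> t * real N \<le> real (Suc j)}"
    have N0: "real N > 0"
      using N by simp
    have unit: "0 \<le> s \<and> s \<le> 1" if "real k \<le> s * real N" "s * real N \<le> real (Suc k)" "k < N" for s k
    proof -
      have "0 \<le> s * real N" "s * real N \<le> 1 * real N"
        using that by linarith+
      then show ?thesis
        using N0 by (simp add: zero_le_mult_iff mult_le_cancel_right)
    qed
    have "?A \<subseteq> ?S"
      using unit[of i] unit[of j] N by auto
    moreover have "diameter ?A \<le> 2 / real N"
    proof (rule diameter_le)
      fix p q assume pq: "p \<in> ?A" "q \<in> ?A"
      obtain s t s' t' where eq: "p = (s, t)" "q = (s', t')"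
        by fastforce
      have "\<bar>s - s'\<bar> * real N \<le> 1" "\<bar>t - t'\<bar> * real N \<le> 1"
        using pq N0 unfolding eq by (auto simp: abs_if algebra_simps)
      then have "\<bar>s - s'\<bar> \<le> 1 / real N" "\<bar>t - t'\<bar> \<le> 1 / real N"
        using N0 by (auto simp: field_simps)
      moreover have "norm (p - q) \<le> \<bar>s - s'\<bar> + \<bar>t - t'\<bar>"
        using norm_Pair_le[of "s - s'" "t - t'"] by (simp add: eq)
      ultimately show "norm (p - q) \<le> 2 / real N"
        by simp
    qed (use N0 in simp)
    moreover have "2 / real N < \<delta>"
    proof -
      have "2 / \<delta> < real N"
        using M N by simp
      then show ?thesis
        using \<delta>(1) N0 by (simp add: field_simps)
    qed
    ultimately obtain v where "?A \<subseteq> T v"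
      using \<delta>(2)[of ?A] by force
    then have "?A \<subseteq> {p \<in> ?S. h p v > 0}"
      using \<open>?A \<subseteq> ?S\<close> T(2)[of v] by blast
    then show "\<exists>v. \<forall>s t. real i \<le> s * real N \<and> s * real N \<le> real (Suc i) \<and>
                real j \<le> t * real N \<and> t * real N \<le> real (Suc j) \<longrightarrow> h (s, t) v > 0"
      by blast
  qed
qed

text \<open>A combinatorial covering: \<open>tr x v\<close> is the point over \<open>v\<close> in
  the star of \<open>x\<close>, which is \<open>x\<close> itself when \<open>v\<close> is its label.
  The law \<open>tr_tr\<close> says that transport inside a simplex does not depend on the route,
  including the return to the starting point.\<close>

locale lifting =
  fixes K :: "'a set set" and V :: "'b set" and lab :: "'b \<Rightarrow> 'a" and tr :: "'b \<Rightarrow> 'a \<Rightarrow> 'b"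
  assumes cx: "simp_complex K"
    and tr_lab: "\<And>x v. x \<in> V \<Longrightarrow> {lab x, v} \<in> K \<Longrightarrow> tr x v \<in> V \<and> lab (tr x v) = v"
    and tr_id: "\<And>x. x \<in> V \<Longrightarrow> tr x (lab x) = x"
    and tr_tr: "\<And>x v w. x \<in> V \<Longrightarrow> {lab x, v, w} \<in> K \<Longrightarrow> tr (tr x v) w = tr x w"
begin

primrec lift :: "'b \<Rightarrow> (nat \<Rightarrow> 'a) \<Rightarrow> nat \<Rightarrow> 'b" where
  "lift x w 0 = tr x (w 0)"
| "lift x w (Suc j) = tr (lift x w j) (w (Suc j))"

lemma lift_lab:
  assumes "x \<in> V" "{lab x, w 0} \<in> K" "\<And>j. Suc j < N \<Longrightarrow> {w j, w (Suc j)} \<in> K" "j < N"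
  shows "lift x w j \<in> V \<and> lab (lift x w j) = w j"
  using assms(4)
proof (induction j)
  case 0
  then show ?case using tr_lab assms(1,2) by simp
next
  case (Suc j)
  then have "lift x w j \<in> V" "{lab (lift x w j), w (Suc j)} \<in> K"
    using assms(3) by auto
  then show ?case using tr_lab by simp
qed

text \<open>Discrete homotopy lifting for one strip: the two rows lie over the sides of a chain of
  squares, each spanning a simplex, and in a simplex both ways from one corner to the opposite one
  lift to the same end.\<close>

lemma lift_adjacent_rows:
  assumes x: "x \<in> V" and start: "{lab x, w 0, w' 0} \<in> K"
    and sq: "\<And>j. Suc j < N \<Longrightarrow> {w j, w (Suc j), w' j, w' (Suc j)} \<in> K" and "j < N"
  shows "lift x w' j = tr (lift x w j) (w' j)"
  using \<open>j < N\<close>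
proof (induction j)
  case 0
  then show ?case using tr_tr[OF x start] by simp
next
  case (Suc j)
  have face: "t \<in> K" if "t \<subseteq> {w j, w (Suc j), w' j, w' (Suc j)}" "t \<noteq> {}" for t
    using simp_complex_face[OF cx sq[OF Suc.prems] that] .
  have face': "{w j, w (Suc j)} \<in> K" if "Suc j < N" for j
    by (rule simp_complex_face[OF cx sq[OF that]]) auto
  have "{lab x, w 0} \<in> K"
    by (rule simp_complex_face[OF cx start]) auto
  then have l: "lift x w j \<in> V" "lab (lift x w j) = w j"
    using lift_lab[of x w N j] x face' Suc.prems by auto
  have "lift x w' (Suc j) = tr (tr (lift x w j) (w' j)) (w' (Suc j))"
    using Suc by simp
  also have "\<dots> = tr (lift x w j) (w' (Suc j))"
    by (rule tr_tr) (use l in \<open>auto intro!: face\<close>)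
  also have "\<dots> = tr (tr (lift x w j) (w (Suc j))) (w' (Suc j))"
    by (rule tr_tr[symmetric]) (use l in \<open>auto intro!: face\<close>)
  finally show ?case by simp
qed

text \<open>A null-homotopy is cut into grid squares, each labelled by a vertex whose open star
  contains its image. Neighbouring rows of labels have lifts with the same end; the last row is
  constant, and the first follows the given walk.\<close>

theorem closed_walk_lifts_closed:
  assumes sc: "simply_connected_space (realization K)"
    and y0: "y 0 \<in> V"
    and step: "\<And>k. k < m \<Longrightarrow> {lab (y k), lab (y (Suc k))} \<in> K \<and> y (Suc k) = tr (y k) (lab (y (Suc k)))"
    and closed: "lab (y m) = lab (y 0)"
  shows "y m = y 0"
proof (cases "m = 0")
  case False
  then have m: "m > 0" by simp
  define u where "u = (\<lambda>k. lab (y k))"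
  define a where "a = (\<lambda>v. if v = u 0 then 1 else 0 :: real)"
  define g where "g = (\<lambda>t. walk u (real m * t))"
  have edge: "{u k, u (Suc k)} \<in> K" if "k < m" for k
    using step[OF that] by (simp add: u_def)
  have g: "pathin (realization K) g" "g 0 = a" "g 1 = a"
    using pathin_walk[of m u K] edge m walk_nat[of u 0] walk_nat[of u m] closed
    by (auto simp: g_def a_def u_def fun_eq_iff)
  then have "homotopic_with (\<lambda>h. h 0 = a \<and> h 1 = a) (top_of_set {0..1}) (realization K) g (\<lambda>_. a)"
    using sc unfolding simply_connected_space_def by blast
  then obtain h :: "real \<times> real \<Rightarrow> 'a \<Rightarrow> real" where H: "continuous_map (top_of_set ({0..1} \<times> {0..1})) (realization K) h \<and>
      (\<forall>t. h (0, t) = g t) \<and> (\<forall>t. h (1, t) = a) \<and> (\<forall>s \<in> {0..1}. h (s, 0) = a \<and> h (s, 1) = a)"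
    unfolding homotopic_with_def prod_topology_subtopology_eu by (rule exE)
  have h: "continuous_map (top_of_set ({0..1} \<times> {0..1})) (realization K) h"
    and h0: "\<And>t. h (0, t) = g t" and h1: "\<And>t. h (1, t) = a"
    and hs: "\<And>s. s \<in> {0..1} \<Longrightarrow> h (s, 0) = a \<and> h (s, 1) = a"
    using H by simp_all
  obtain M :: nat where M: "M > 0" and grid: "\<And>N i j. M \<le> N \<Longrightarrow> i < N \<Longrightarrow> j < N \<Longrightarrow>
      \<exists>v. \<forall>s t. real i \<le> s * real N \<and> s * real N \<le> real (Suc i) \<and>
                real j \<le> t * real N \<and> t * real N \<le> real (Suc j) \<longrightarrow> h (s, t) v > 0"
    using grid_open_stars[OF h] by metis
  \<comment> \<open>With a multiple of \<open>m\<close>, every edge of the walk occupies exactly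
    \<open>M\<close> columns of the grid.\<close>
  define N where "N = m * M"
  have N: "N > 0" "M \<le> N"
    using m M by (auto simp: N_def)
  obtain v where v: "\<And>i j s t. i < N \<Longrightarrow> j < N \<Longrightarrow> real i \<le> s * real N \<Longrightarrow> s * real N \<le> real (Suc i) \<Longrightarrow>
      real j \<le> t * real N \<Longrightarrow> t * real N \<le> real (Suc j) \<Longrightarrow> h (s, t) (v i j) > 0"
    using grid[OF N(2)] by metis
  \<comment> \<open>The point \<open>a\<close> is the vertex \<open>u 0\<close> and lies in no other
    open star. So all squares touching one of the three sides where the homotopy is constant are
    labelled \<open>u 0\<close>.\<close>
  have v_a: "v i j = u 0" if "a (v i j) > 0" for i j
    using that by (simp add: a_def split: if_splits)
  have v_start: "v i 0 = u 0" if "i < N" for i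
    using v[OF that N(1), of "real i / real N" 0] hs[of "real i / real N"] that N by (intro v_a) auto
  have v_end: "v i (N - 1) = u 0" if "i < N" for i
    using v[OF that, of "N - 1" "real i / real N" 1] hs[of "real i / real N"] that N by (intro v_a) auto
  have v_last: "v (N - 1) j = u 0" if "j < N" for j
    using v[OF _ that, of "N - 1" 1 "real j / real N"] h1 that N by (intro v_a) auto
  have square: "{v i j, v i (Suc j), v (Suc i) j, v (Suc i) (Suc j)} \<in> K" if "Suc i < N" "Suc j < N" for i j
  proof (rule realization_support_simplex[OF cx])
    \<comment> \<open>The corner common to the four grid squares; it lies in the open stars of all
      four labels.\<close>
    let ?p = "(real (Suc i) / real N, real (Suc j) / real N)"
    show "h ?p \<in> topspace (realization K)"
      using continuous_map_funspace[OF h] that N by auto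
    show "h ?p w > 0" if "w \<in> {v i j, v i (Suc j), v (Suc i) j, v (Suc i) (Suc j)}" for w
      using that \<open>Suc i < N\<close> \<open>Suc j < N\<close> N by (auto intro!: v)
  qed simp
  \<comment> \<open>The given walk slowed down, each vertex repeated \<open>M\<close> times. It
    stops at \<open>u (m - 1)\<close>; the closing step to \<open>u m\<close> is recovered at the
    end.\<close>
  define w where "w = (\<lambda>j. u (j div M))"
  have div_lt: "j div M < m" if "j < N" for j
    using that M by (simp add: N_def less_mult_imp_div_less)
  have yV: "y k \<in> V" if "k \<le> m" for k
    using that
  proof (induction k)
    case (Suc k)
    then show ?case using step[of k] tr_lab[of "y k" "lab (y (Suc k))"] by simp
  qed (simp add: y0)
  have lift_w: "lift (y 0) w j = y (j div M)" if "j < N" for j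
    using that
  proof (induction j)
    case 0
    then show ?case using tr_id[OF y0] by (simp add: w_def u_def)
  next
    case (Suc j)
    show ?case
    proof (cases "Suc j div M = j div M")
      case True
      then show ?thesis
        using Suc tr_id[OF yV, of "j div M"] div_lt[of j] by (simp add: w_def u_def)
    next
      case False
      then have "Suc j div M = Suc (j div M)"
        by (simp add: div_Suc split: if_splits)
      then show ?thesis
        using Suc step[of "j div M"] div_lt[of j] by (simp add: w_def u_def)
    qed
  qed
  \<comment> \<open>Columns \<open>j\<close> and \<open>Suc j\<close> meet at a point which the walk
    reaches while on the closed edge number \<open>j div M\<close>, even if \<open>Suc j\<close> is
    a multiple of \<open>M\<close>. Both labels are thus ends of that edge, which makes the first
    row adjacent to \<open>w\<close>.\<close>
  have v0: "v 0 i \<in> {u (j div M), u (Suc (j div M))}" if "Suc j < N" "i = j \<or> i = Suc j" for i j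
  proof -
    let ?t = "real (Suc j) / real N"
    have "h (0, ?t) (v 0 i) > 0"
      using v[of 0 i 0 ?t] that N by auto
    then have pos: "walk u (real m * ?t) (v 0 i) > 0"
      by (simp add: h0 g_def)
    have eq: "real m * ?t = real (Suc j) / real M"
      using m M by (simp add: N_def field_simps)
    have "j div M * M \<le> j" "Suc j \<le> Suc (j div M) * M"
      using M by (auto simp: div_times_less_eq_dividend Suc_le_eq dividend_less_div_times)
    then have "real (j div M) * real M \<le> real (Suc j)" "real (Suc j) \<le> real (Suc (j div M)) * real M"
      by (simp_all only: flip: of_nat_mult of_nat_le_iff)
    then have "real (j div M) \<le> real m * ?t" "real m * ?t \<le> real (Suc (j div M))"
      using M unfolding eq by (auto simp: pos_le_divide_eq pos_divide_le_eq)
    then show ?thesis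
      using walk_support pos by metis
  qed
  have first: "lift (y 0) (v 0) j = tr (lift (y 0) w j) (v 0 j)" if "j < N" for j
  proof (rule lift_adjacent_rows[where N = N])
    have "{u 0} \<in> K"
      by (rule simp_complex_face[OF cx edge[OF m]]) auto
    then show "{lab (y 0), w 0, v 0 0} \<in> K"
      using v_start[OF N(1)] by (simp add: w_def u_def)
    show "{w j, w (Suc j), v 0 j, v 0 (Suc j)} \<in> K" if "Suc j < N" for j
    proof (rule simp_complex_face[OF cx edge])
      show "j div M < m" using div_lt that by simp
      have "Suc j div M = j div M \<or> Suc j div M = Suc (j div M)"
        by (simp add: div_Suc)
      then show "{w j, w (Suc j), v 0 j, v 0 (Suc j)} \<subseteq> {u (j div M), u (Suc (j div M))}"
        using v0[OF that] by (auto simp: w_def)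
    qed simp
  qed (use y0 that in auto)
  have u0: "{u 0} \<in> K"
    by (rule simp_complex_face[OF cx edge[OF m]]) auto
  have rowV: "lift (y 0) (v i) j \<in> V \<and> lab (lift (y 0) (v i) j) = v i j" if "Suc i < N" "j < N" for i j
  proof (rule lift_lab[where N = N])
    show "{lab (y 0), v i 0} \<in> K"
      using u0 v_start that by (simp add: u_def)
    show "{v i j, v i (Suc j)} \<in> K" if "Suc j < N" for j
      by (rule simp_complex_face[OF cx square[OF \<open>Suc i < N\<close> that]]) auto
  qed (use y0 that in auto)
  have next_row: "lift (y 0) (v (Suc i)) (N - 1) = lift (y 0) (v i) (N - 1)" if "Suc i < N" for i
  proof -
    have "lift (y 0) (v (Suc i)) (N - 1) = tr (lift (y 0) (v i) (N - 1)) (v (Suc i) (N - 1))"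
      by (rule lift_adjacent_rows[OF y0, where N = N])
         (use u0 v_start square that N in \<open>auto simp: u_def\<close>)
    also have "\<dots> = lift (y 0) (v i) (N - 1)"
      using rowV[OF that, of "N - 1"] tr_id v_end that N by (metis Suc_lessD diff_less zero_less_one)
    finally show ?thesis .
  qed
  have rows: "lift (y 0) (v i) (N - 1) = lift (y 0) (v 0) (N - 1)" if "i < N" for i
    using that next_row by (induction i) auto
  have last: "lift (y 0) (v (N - 1)) j = y 0" if "j < N" for j
    using that v_last tr_id[OF y0] by (induction j) (auto simp: u_def)
  have "(N - 1) div M = m - 1"
  proof -
    obtain m' where "m = Suc m'"
      using m by (cases m) auto
    then show ?thesis
      using M by (intro div_nat_eqI) (auto simp: N_def algebra_simps)
  qed
  \<comment> \<open>The last label \<open>u 0\<close> equals \<open>u m\<close>, so this transport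
    is the missing closing step of the walk.\<close>
  then have "lift (y 0) (v 0) (N - 1) = tr (y (m - 1)) (u 0)"
    using first[of "N - 1"] lift_w[of "N - 1"] v_end[of 0] N by simp
  also have "\<dots> = y m"
    using step[of "m - 1"] m closed by (simp add: u_def)
  finally show ?thesis
    using rows[of "N - 1"] last[of "N - 1"] N by simp
qed simp

end

section \<open>The universal cover\<close>

text \<open>
  The label is the vertex of the complex under the covering map. Recording the finite set of lower
  neighbours makes the choice-free quotient of pairs (lower neighbour, label) a plain datatype.
\<close>

datatype 'a cov = Cov (lab: 'a) (down: "'a cov fset")

definition below :: "'a cov \<Rightarrow> 'a cov set" where
  "below x = fset (down x)"

lemma cov_eqI: "lab x = lab y \<Longrightarrow> below x = below y \<Longrightarrow> x = y"
  by (simp add: below_def fset_inject cov.expand)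

text \<open>The conditions on links, stated by edges and triangles of \<open>X\<close> at
  \<open>v\<close>: \<open>link_flag\<close> is flagness of the link, and \<open>link4\<close> and
  \<open>link5\<close> provide diagonals in its cycles of lengths 4 and 5.\<close>

locale locally_6_large_complex =
  fixes X :: "'a set set" and v0 :: 'a
  assumes cx: "simp_complex X"
    and link_flag: "\<And>v A. \<lbrakk>A \<noteq> {}; \<And>a. a \<in> A \<Longrightarrow> edg X v a; \<And>a b. \<lbrakk>a \<in> A; b \<in> A; a \<noteq> b\<rbrakk> \<Longrightarrow> tri X v a b\<rbrakk>
        \<Longrightarrow> insert v A \<in> X"
    and link4: "\<And>v a b c d. \<lbrakk>tri X v a b; tri X v b c; tri X v c d; tri X v d a; a \<noteq> c; b \<noteq> d\<rbrakk>
        \<Longrightarrow> tri X v a c \<or> tri X v b d"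
    and link5: "\<And>v a b c d e. \<lbrakk>tri X v a b; tri X v b c; tri X v c d; tri X v d e; tri X v e a; distinct [a,b,c,d,e]\<rbrakk>
        \<Longrightarrow> tri X v a c \<or> tri X v b d \<or> tri X v c e \<or> tri X v d a \<or> tri X v e b"
begin

lemma subsimplex: "s \<in> X \<Longrightarrow> t \<subseteq> s \<Longrightarrow> t \<noteq> {} \<Longrightarrow> t \<in> X"
  by (rule simp_complex_face[OF cx])

lemma tri_edg: "tri X a b c \<Longrightarrow> edg X a b" "tri X a b c \<Longrightarrow> edg X b c" "tri X a b c \<Longrightarrow> edg X a c"
  unfolding tri_def edg_def by (auto elim!: subsimplex)

text \<open>Three pairwise adjacent vertices of the link of \<open>v\<close> span a simplex with
  \<open>v\<close>; the conclusion is its face opposite to \<open>v\<close>.\<close>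

lemma flag3:
  assumes "tri X v a b" "tri X v b c" "tri X v a c"
  shows "tri X a b c"
proof -
  have "insert v {a, b, c} \<in> X"
    by (rule link_flag)
      (use assms tri_edg(1)[OF assms(1)] tri_edg(3)[OF assms(1)] tri_edg(3)[OF assms(2)]
         tri_perm(2)[OF assms(1)] tri_perm(2)[OF assms(2)] tri_perm(2)[OF assms(3)] in auto)
  then have "{a, b, c} \<in> X"
    by (rule subsimplex) auto
  then show ?thesis
    using assms by (auto simp: tri_def)
qed

text \<open>
  Horizontal adjacency. It suffices to look at edges with a common lower neighbour because the
  projection of an edge is not empty.
\<close>

definition hadj :: "'a cov \<Rightarrow> 'a cov \<Rightarrow> bool" where
  "hadj x y \<longleftrightarrow> (\<exists>w \<in> below x \<inter> below y. tri X (lab w) (lab x) (lab y))"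

definition adj :: "'a cov \<Rightarrow> 'a cov \<Rightarrow> bool" where
  "adj x y \<longleftrightarrow> hadj x y \<or> x \<in> below y \<or> y \<in> below x"

text \<open>The neighbours of \<open>w\<close> that exist before the level above it is
  built.\<close>

definition nb :: "'a cov set \<Rightarrow> 'a cov \<Rightarrow> 'a cov set" where
  "nb L w = below w \<union> {u \<in> L. hadj u w}"

definition fresh :: "'a cov set \<Rightarrow> 'a cov \<Rightarrow> 'a \<Rightarrow> bool" where
  "fresh L w z \<longleftrightarrow> w \<in> L \<and> edg X (lab w) z \<and> z \<notin> lab ` nb L w"

text \<open>The equivalence class of \<open>w\<close> among the points at which a neighbour labelled
  \<open>z\<close> has to be added, two of them being identified when they form a triangle with
  \<open>z\<close>. That a single step from \<open>w\<close> reaches the whole class is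
  \<open>fibre_eq\<close>.\<close>

definition fibre :: "'a cov set \<Rightarrow> 'a cov \<Rightarrow> 'a \<Rightarrow> 'a cov set" where
  "fibre L w z = insert w {u \<in> L. hadj u w \<and> tri X (lab u) (lab w) z}"

primrec level :: "nat \<Rightarrow> 'a cov set" where
  "level 0 = {Cov v0 {||}}"
| "level (Suc n) = {x. \<exists>w. fresh (level n) w (lab x) \<and> below x = fibre (level n) w (lab x)}"

lemma hadj_sym: "hadj x y \<Longrightarrow> hadj y x"
  unfolding hadj_def by (metis Int_commute tri_perm(2))

lemma adj_sym: "adj x y \<Longrightarrow> adj y x"
  unfolding adj_def by (metis hadj_sym)

lemma hadj_edg: "hadj x y \<Longrightarrow> edg X (lab x) (lab y)"
  unfolding hadj_def using tri_edg(2) by blast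

lemma below_level_0: "x \<in> level 0 \<Longrightarrow> below x = {}"
  by (simp add: below_def)

declare level.simps(2) [simp del]

lemma below_level_Suc: "x \<in> level (Suc n) \<Longrightarrow> below x \<subseteq> level n"
  by (auto simp: level.simps(2) fresh_def fibre_def)

lemma below_ne: "x \<in> level (Suc n) \<Longrightarrow> below x \<noteq> {}"
  by (auto simp: level.simps(2) fibre_def)

lemma below_edg: "x \<in> level n \<Longrightarrow> w \<in> below x \<Longrightarrow> edg X (lab w) (lab x)"
  by (cases n) (auto simp: level.simps(2) below_level_0 fresh_def fibre_def dest: tri_edg simp del: level.simps(1))

lemma below_levelE:
  assumes "y \<in> level m" "x \<in> below y"
  obtains k where "m = Suc k" "x \<in> level k"
proof (cases m)
  case 0
  then show ?thesis using assms below_level_0 by blast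
next
  case (Suc k)
  then show ?thesis using assms below_level_Suc that by blast
qed

text \<open>A lower neighbour of \<open>x\<close> lies in the preceding level for either index, and
  only the root has nothing below it.\<close>

lemma level_unique: "x \<in> level n \<Longrightarrow> x \<in> level m \<Longrightarrow> n = m"
proof (induction n arbitrary: x m)
  case 0
  then have "below x = {}"
    by (intro below_level_0)
  then show ?case
    using below_ne[of x] 0 by (cases m) auto
next
  case (Suc n)
  obtain w where w: "w \<in> below x"
    using below_ne[OF Suc.prems(1)] by blast
  obtain k where k: "m = Suc k" "w \<in> level k"
    using Suc.prems(2) w by (rule below_levelE)
  moreover have "w \<in> level n"
    using below_level_Suc[OF Suc.prems(1)] w by blast
  ultimately show ?case
    using Suc.IH by simp
qed

lemma below_level:
  assumes "x \<in> level n" "y \<in> level m" "x \<in> below y"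
  shows "m = Suc n"
  using assms(2,3) by (rule below_levelE) (use level_unique assms(1) in auto)

lemma adj_same:
  assumes "x \<in> level n" "y \<in> level n"
  shows "adj x y \<longleftrightarrow> hadj x y"
  using assms below_level[of x n y n] below_level[of y n x n] unfolding adj_def by auto

lemma hadj_level:
  assumes "x \<in> level n" "y \<in> level m" "hadj x y"
  shows "n = m"
proof -
  obtain w where w: "w \<in> below x" "w \<in> below y"
    using assms by (auto simp: hadj_def)
  obtain k where k: "n = Suc k" "w \<in> level k"
    using assms(1) w(1) by (rule below_levelE)
  then show ?thesis
    using below_level[OF k(2) assms(2) w(2)] by simp
qed

lemma adj_up:
  assumes "x \<in> level n" "y \<in> level (Suc n)"
  shows "adj x y \<longleftrightarrow> x \<in> below y"
  using assms hadj_level[of x n y "Suc n"] below_level[of y "Suc n" x n] unfolding adj_def by auto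

lemma adj_level:
  assumes "x \<in> level n" "y \<in> level m" "adj x y"
  shows "m = n \<or> m = Suc n \<or> n = Suc m"
  using assms(3) hadj_level[OF assms(1,2)] below_level[OF assms(1,2)] below_level[OF assms(2,1)]
  unfolding adj_def by blast

lemma adj_below:
  assumes "x \<in> level n" "y \<in> level n" "p \<in> below y" "adj x p"
  shows "p \<in> below x"
proof -
  obtain k where k: "n = Suc k" "p \<in> level k"
    using assms(2,3) by (rule below_levelE)
  then show ?thesis
    using adj_up[of p k x] adj_sym[OF assms(4)] assms(1) by simp
qed

lemma nb_levelE:
  assumes "p \<in> level n" "y \<in> nb (level n) p"
  obtains "y \<in> level n" "hadj y p" | k where "n = Suc k" "y \<in> level k" "y \<in> below p"
  using assms(2) below_levelE[OF assms(1), of y] that unfolding nb_def by blast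

text \<open>
  The last clause says that the star of a vertex is already complete near its lower neighbours. It
  excludes the diagonals ending at the new vertex in the 4- and 5-cycles of \<open>fibre_clique\<close>.
\<close>

definition coherent :: "nat \<Rightarrow> bool" where
  "coherent n \<longleftrightarrow> (\<forall>x \<in> level n. inj_on lab (nb (level n) x) \<and>
     (\<forall>y \<in> nb (level n) x. \<forall>y' \<in> nb (level n) x. y \<noteq> y' \<longrightarrow>
        adj y y' = tri X (lab x) (lab y) (lab y')) \<and>
     (\<forall>w \<in> below x. \<forall>w' \<in> below x. w \<noteq> w' \<longrightarrow> hadj w w') \<and>
     (\<forall>p \<in> below x. \<forall>z. tri X (lab x) (lab p) z \<longrightarrow> z \<in> lab ` nb (level n) x))"

lemma coherent_0: "coherent 0"
  by (auto simp: coherent_def nb_def hadj_def below_def)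

section \<open>From one level to the next\<close>

context
  fixes n assumes coherent: "coherent n"
begin

lemma inj_nb: "x \<in> level n \<Longrightarrow> y \<in> nb (level n) x \<Longrightarrow> y' \<in> nb (level n) x \<Longrightarrow> lab y = lab y' \<Longrightarrow> y = y'"
  using coherent unfolding coherent_def inj_on_def by blast

lemma adj_nb:
  "x \<in> level n \<Longrightarrow> y \<in> nb (level n) x \<Longrightarrow> y' \<in> nb (level n) x \<Longrightarrow> y \<noteq> y' \<Longrightarrow>
    adj y y' \<longleftrightarrow> tri X (lab x) (lab y) (lab y')"
  using coherent unfolding coherent_def by blast

lemma below_clique: "x \<in> level n \<Longrightarrow> w \<in> below x \<Longrightarrow> w' \<in> below x \<Longrightarrow> w \<noteq> w' \<Longrightarrow> hadj w w'"
  using coherent unfolding coherent_def by blast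

lemma tri_below_nb: "x \<in> level n \<Longrightarrow> p \<in> below x \<Longrightarrow> tri X (lab x) (lab p) z \<Longrightarrow> z \<in> lab ` nb (level n) x"
  using coherent unfolding coherent_def by metis

lemma fresh_not_tri: "fresh (level n) w z \<Longrightarrow> p \<in> below w \<Longrightarrow> \<not> tri X (lab w) (lab p) z"
  using tri_below_nb unfolding fresh_def by metis

lemma below_tri:
  assumes "x \<in> level n" "w \<in> below x" "w' \<in> below x" "w \<noteq> w'"
  shows "tri X (lab x) (lab w) (lab w')"
  using adj_nb[of x w w'] below_clique[of x w w'] assms by (auto simp: nb_def adj_def)

lemma adj_nb_sub:
  assumes "w \<in> level n" "u \<in> level n" "y \<in> nb (level n) u" "adj y w"
  shows "y \<in> nb (level n) w"
proof -
  show ?thesis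
    using assms(2,3)
  proof (cases rule: nb_levelE)
    case 1
    then show ?thesis using assms adj_same unfolding nb_def by blast
  next
    case (2 k)
    then show ?thesis using adj_up[of y k w] assms unfolding nb_def by blast
  qed
qed

lemma hadj_tri:
  assumes "w \<in> level n" "u \<in> level n" "u' \<in> level n" "hadj u w" "hadj u' w" "u \<noteq> u'"
  shows "hadj u u' \<longleftrightarrow> tri X (lab w) (lab u) (lab u')"
  using adj_nb[of w u u'] adj_same assms by (auto simp: nb_def)

text \<open>A neighbour \<open>y\<close> of \<open>u\<close> labelled \<open>z\<close> would form a
  triangle with \<open>u\<close> and \<open>w\<close>, hence be a neighbour of \<open>w\<close> too,
  where no such label occurs.\<close>

lemma fresh_fibre:
  assumes "fresh (level n) w z" "u \<in> fibre (level n) w z"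
  shows "fresh (level n) u z"
proof (cases "u = w")
  case False
  then have u: "u \<in> level n" "hadj u w" "tri X (lab u) (lab w) z"
    using assms by (auto simp: fibre_def)
  have w: "w \<in> level n"
    using assms by (auto simp: fresh_def)
  have False if y: "y \<in> nb (level n) u" "lab y = z" for y
  proof -
    have "y \<noteq> w"
      using u y by (auto simp: tri_def)
    moreover have "w \<in> nb (level n) u"
      using u w hadj_sym by (auto simp: nb_def)
    ultimately have "adj y w"
        using adj_nb[of u y w] u y tri_perm(2) by metis
    then have "y \<in> nb (level n) w"
      using adj_nb_sub u w y by blast
    then show False
      using assms y by (auto simp: fresh_def)
  qed
  then show ?thesis
    using u tri_edg unfolding fresh_def by blast
qed (use assms in simp)

text \<open>In the link of \<open>lab w\<close> the labels of \<open>u\<close>, \<open>z\<close>,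
  \<open>u'\<close> close up through lower neighbours of \<open>w\<close> to a 4- or 5-cycle. No
  diagonal ends at \<open>z\<close>, because the star of \<open>w\<close> is complete near its lower
  neighbours and \<open>z\<close> is not in it.\<close>

lemma fibre_clique:
  assumes fresh: "fresh (level n) w z" and "u \<in> fibre (level n) w z" "u' \<in> fibre (level n) w z" "u \<noteq> u'"
  shows "hadj u u' \<and> tri X (lab u) (lab u') z"
proof -
  have w: "w \<in> level n"
    using fresh by (auto simp: fresh_def)
  have core: "tri X (lab w) (lab u) (lab u')" if u: "u \<in> level n" "hadj u w" "tri X (lab u) (lab w) z"
     and u': "u' \<in> level n" "hadj u' w" "tri X (lab u') (lab w) z"
   proof -
    \<comment> \<open>With one lower neighbour \<open>p\<close> common to all three, the cycle is
      \<open>z, u, p, u'\<close>; the diagonal at \<open>z\<close> being impossible, the other one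
      is the claim.\<close>
    have four: ?thesis if p: "p \<in> below w" "p \<in> below u" "p \<in> below u'" for p
    proof -
      have nb: "p \<in> nb (level n) w" "u \<in> nb (level n) w" "u' \<in> nb (level n) w"
        using p u u' by (auto simp: nb_def)
      have "u \<noteq> p" "u' \<noteq> p"
        using p u u' adj_same adj_def hadj_def below_level by (metis n_not_Suc_n)+
      then have t: "tri X (lab w) (lab u) (lab p)" "tri X (lab w) (lab u') (lab p)"
        using adj_nb[OF w] nb p by (auto simp: adj_def)
      have "z \<noteq> lab p"
        using fresh nb by (auto simp: fresh_def)
      moreover have "lab u \<noteq> lab u'"
        using nb inj_nb w \<open>u \<noteq> u'\<close> by blast
      ultimately have "tri X (lab w) z (lab p) \<or> tri X (lab w) (lab u) (lab u')"
        using link4[OF tri_perm(3)[OF u(3)] t(1) tri_perm(2)[OF t(2)] tri_perm(1)[OF u'(3)]] by blast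
      then show ?thesis
        using fresh_not_tri[OF fresh p(1)] tri_perm(2) by metis
    qed
    obtain p where p: "p \<in> below w" "p \<in> below u"
      using u by (auto simp: hadj_def)
    obtain p' where p': "p' \<in> below w" "p' \<in> below u'"
      using u' by (auto simp: hadj_def)
    show ?thesis
    proof (cases "p = p'")
      case True
      then show ?thesis using p p' four by blast
    next
      case False
      have nb: "p \<in> nb (level n) w" "p' \<in> nb (level n) w" "u \<in> nb (level n) w" "u' \<in> nb (level n) w"
        using p p' u u' by (auto simp: nb_def)
      have ne: "u \<noteq> p" "u' \<noteq> p" "u \<noteq> p'" "u' \<noteq> p'"
        using p p' u u' below_level w by (metis n_not_Suc_n)+
      have t: "tri X (lab w) (lab u) (lab p)" "tri X (lab w) (lab u') (lab p')"
        using adj_nb[OF w] nb p p' ne by (auto simp: adj_def)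
      have t2: "tri X (lab w) (lab p) (lab p')"
        using below_tri w p p' False by blast
      have "distinct [lab p, lab p', lab u, lab u']"
        using inj_nb[OF w] nb ne \<open>u \<noteq> u'\<close> False by auto
      moreover have "z \<noteq> lab p" "z \<noteq> lab p'" "z \<noteq> lab u" "z \<noteq> lab u'"
        using fresh nb by (auto simp: fresh_def)
      ultimately have "distinct [z, lab u, lab p, lab p', lab u']"
        by auto
      \<comment> \<open>The cycle is \<open>z, u, p, p', u'\<close>. Its diagonals at
        \<open>z\<close> are impossible, \<open>u' u\<close> is the claim, and each of the other two
        makes one lower neighbour common to all three points.\<close>
      then consider "tri X (lab w) z (lab p)" | "tri X (lab w) (lab u) (lab p')" |
         "tri X (lab w) (lab p) (lab u')" | "tri X (lab w) (lab p') z" | "tri X (lab w) (lab u') (lab u)"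
        using link5[OF tri_perm(3)[OF u(3)] t(1) t2 tri_perm(2)[OF t(2)] tri_perm(1)[OF u'(3)]] by blast
      then show ?thesis
      proof cases
        case 1
        then show ?thesis using fresh_not_tri[OF fresh p(1)] tri_perm(2) by metis
      next
        case 2
        then have "adj u p'" using adj_nb[OF w] nb ne by blast
        then have "p' \<in> below u"
          using adj_below[OF u(1) w p'(1)] by blast
        then show ?thesis using four p' by blast
      next
        case 3
        then have "adj p u'" using adj_nb[OF w, of p u'] nb ne by blast
        then have "p \<in> below u'"
          using adj_below[OF u'(1) w p(1)] adj_sym by blast
        then show ?thesis using four p by blast
      next
        case 4
        then show ?thesis using fresh_not_tri[OF fresh p'(1)] by blast
      next
        case 5
        then show ?thesis using tri_perm(2) by metis
      qed
    qed
  qed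
  show ?thesis
  proof (cases "u = w \<or> u' = w")
    case True
    then show ?thesis
      using assms hadj_sym[of u w] hadj_sym[of u' w] tri_perm(1)[of X "lab u'" "lab w" z] unfolding fibre_def by auto
  next
    case False
    then have u: "u \<in> level n" "hadj u w" "tri X (lab u) (lab w) z"
     and u': "u' \<in> level n" "hadj u' w" "tri X (lab u') (lab w) z"
      using assms by (auto simp: fibre_def)
    have "hadj u u'"
      using core hadj_tri u u' w \<open>u \<noteq> u'\<close> by blast
    moreover have "tri X (lab u) (lab u') z"
      using flag3[OF core[OF u u'] tri_perm(1)[OF u'(3)] tri_perm(1)[OF u(3)]] .
    ultimately show ?thesis by blast
  qed
qed

text \<open>A fibre is a clique whose members all form triangles with \<open>z\<close>, so each of
  its members generates the whole of it.\<close>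

lemma fibre_eq:
  assumes fresh: "fresh (level n) w z" and u: "u \<in> fibre (level n) w z"
  shows "fibre (level n) u z = fibre (level n) w z"
proof -
  have sub: "fibre (level n) w z \<subseteq> fibre (level n) u z" if "fresh (level n) w z" "u \<in> fibre (level n) w z" for u w
  proof
    fix v assume v: "v \<in> fibre (level n) w z"
    then have "v \<in> level n"
      using that by (auto simp: fibre_def fresh_def)
    then show "v \<in> fibre (level n) u z"
      using fibre_clique that v unfolding fibre_def[of _ u] by blast
  qed
  have "w \<in> fibre (level n) u z"
    using sub fresh u by (auto simp: fibre_def)
  then show ?thesis
    using sub[OF fresh u] sub[OF fresh_fibre[OF fresh u]] by blast
qed

lemma fibre_inj:
  assumes fresh: "fresh (level n) w z" shows "inj_on lab (fibre (level n) w z)"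
  using fibre_clique[OF fresh] by (force simp: inj_on_def tri_def)

text \<open>By flagness of the link of \<open>z\<close> the labels of a fibre span a simplex
  together with \<open>z\<close>. Finiteness is what allows a fibre to be stored in the field
  \<open>down\<close>.\<close>

lemma fibre_finite:
  assumes fresh: "fresh (level n) w z" shows "finite (fibre (level n) w z)"
proof -
  have "insert z (lab ` fibre (level n) w z) \<in> X"
  proof (rule link_flag)
    show "lab ` fibre (level n) w z \<noteq> {}" by (auto simp: fibre_def)
    show "edg X z a" if "a \<in> lab ` fibre (level n) w z" for a
      using that fresh_fibre[OF fresh] by (auto simp: fresh_def intro: edg_sym)
    show "tri X z a b" if "a \<in> lab ` fibre (level n) w z" "b \<in> lab ` fibre (level n) w z" "a \<noteq> b" for a b
    proof -
      obtain u u' where u: "u \<in> fibre (level n) w z" "u' \<in> fibre (level n) w z" "a = lab u" "b = lab u'"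
        using \<open>a \<in> _\<close> \<open>b \<in> _\<close> by blast
      with \<open>a \<noteq> b\<close> have "u \<noteq> u'" by blast
      then have "tri X (lab u) (lab u') z"
        using fibre_clique[OF fresh u(1,2)] by blast
      then show ?thesis
        unfolding u(3,4) by (rule tri_perm(4))
    qed
  qed
  then have "finite (lab ` fibre (level n) w z)"
    using cx unfolding simp_complex_def by (metis finite_insert)
  then show ?thesis
    using fibre_inj[OF fresh] finite_imageD by blast
qed

lemma fresh_ex:
  assumes fresh: "fresh (level n) w z" shows "\<exists>x \<in> level (Suc n). lab x = z \<and> below x = fibre (level n) w z"
proof
  let ?x = "Cov z (Abs_fset (fibre (level n) w z))"
  show "lab ?x = z \<and> below ?x = fibre (level n) w z"
    using fibre_finite[OF fresh] by (simp add: below_def Abs_fset_inverse)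
  then show "?x \<in> level (Suc n)"
    using fresh by (auto simp: level.simps(2))
qed

section \<open>Stars in the new level\<close>

lemma below_fresh:
  assumes "x \<in> level (Suc n)" "w \<in> below x"
  shows "fresh (level n) w (lab x)" "below x = fibre (level n) w (lab x)"
proof -
  obtain v where v: "fresh (level n) v (lab x)" "below x = fibre (level n) v (lab x)"
    using assms(1) unfolding level.simps(2) by blast
  then have w: "w \<in> fibre (level n) v (lab x)"
    using assms(2) by simp
  show "fresh (level n) w (lab x)"
    by (rule fresh_fibre[OF v(1) w])
  show "below x = fibre (level n) w (lab x)"
    using fibre_eq[OF v(1) w] v(2) by simp
qed

lemma below_memI:
  assumes "x \<in> level (Suc n)" "w \<in> below x" "u \<in> level n" "hadj u w" "tri X (lab u) (lab w) (lab x)"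
  shows "u \<in> below x"
  using below_fresh[OF assms(1,2)] assms by (auto simp: fibre_def)

lemma level_eqI:
  assumes "x \<in> level (Suc n)" "y \<in> level (Suc n)" "lab x = lab y" "w \<in> below x" "w \<in> below y"
  shows "x = y"
  using below_fresh(2)[OF assms(1,4)] below_fresh(2)[OF assms(2,5)] assms(3) by (intro cov_eqI) simp_all

lemma below_clique':
  assumes "x \<in> level (Suc n)" "w \<in> below x" "w' \<in> below x" "w \<noteq> w'"
  shows "hadj w w'" "tri X (lab w) (lab w') (lab x)"
  using fibre_clique[OF below_fresh(1)[OF assms(1,2)], of w w'] below_fresh(2)[OF assms(1,2)] assms(2-4) by auto

text \<open>Otherwise the label of \<open>y\<close> would already occur in the star of the common
  lower neighbour \<open>p\<close>, contrary to its being fresh there.\<close>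

lemma below_lab_ne:
  assumes "x \<in> level (Suc n)" "w \<in> below x" "p \<in> below x" "p \<in> below y" "y \<in> level (Suc n)"
  shows "lab w \<noteq> lab y"
proof (cases "w = p")
  case True
  then show ?thesis using below_edg assms by (metis edg_def)
next
  case False
  then have "w \<in> nb (level n) p"
    using assms below_clique' below_level_Suc unfolding nb_def by blast
  then show ?thesis
    using below_fresh(1)[OF assms(5,4)] unfolding fresh_def by (metis imageI)
qed

text \<open>A common lower neighbour \<open>p\<close> of \<open>x\<close> and \<open>y\<close> is
  adjacent to \<open>w\<close>. Flagness in the link of \<open>lab p\<close> gives one direction; in
  the link of \<open>lab x\<close> it gives a triangle of \<open>w\<close>, \<open>p\<close>,
  \<open>y\<close>, which puts \<open>w\<close> into the fibre below \<open>y\<close>.\<close>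

lemma below_iff_tri:
  assumes x: "x \<in> level (Suc n)" and y: "y \<in> level (Suc n)" and h: "hadj x y" and w: "w \<in> below x"
  shows "w \<in> below y \<longleftrightarrow> tri X (lab w) (lab x) (lab y)"
proof -
  obtain p where p: "p \<in> below x" "p \<in> below y" "tri X (lab p) (lab x) (lab y)"
    using h by (auto simp: hadj_def)
  show ?thesis
  proof (cases "p = w")
    case True
    then show ?thesis using p by simp
  next
    case False
    have wp: "hadj p w" "tri X (lab p) (lab w) (lab x)"
      using below_clique'[OF x] p w False by blast+
    have wL: "w \<in> level n" using below_level_Suc x w by blast
    show ?thesis
    proof
      assume "w \<in> below y"
      then have "tri X (lab p) (lab w) (lab y)"
        using below_clique'[OF y] p False by blast
      then show "tri X (lab w) (lab x) (lab y)"
        using flag3[of "lab p" "lab w" "lab x" "lab y"] p wp by blast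
    next
      assume t: "tri X (lab w) (lab x) (lab y)"
      have "tri X (lab w) (lab p) (lab y)"
        by (rule flag3[OF tri_perm(5)[OF wp(2)] tri_perm(1)[OF p(3)] tri_perm(1)[OF t]])
      then show "w \<in> below y"
        using below_memI[OF y p(2) wL hadj_sym[OF wp(1)]] by blast
    qed
  qed
qed

lemma hadj_hadj_common:
  assumes x: "x \<in> level (Suc n)" and y: "y \<in> level (Suc n)" and y': "y' \<in> level (Suc n)"
    and h: "hadj x y" "hadj x y'" and r: "r \<in> below x" "r \<in> below y" "r \<in> below y'"
  shows "hadj y y' \<longleftrightarrow> tri X (lab x) (lab y) (lab y')"
proof -
  have t: "tri X (lab r) (lab x) (lab y)" "tri X (lab r) (lab x) (lab y')"
    using below_iff_tri x y y' h r by blast+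
  have "tri X (lab r) (lab y) (lab y') \<longleftrightarrow> hadj y y'"
    using r below_iff_tri[OF y y'] by (auto simp: hadj_def)
  moreover have "tri X (lab r) (lab y) (lab y') \<longleftrightarrow> tri X (lab x) (lab y) (lab y')"
    using flag3[OF t(1) _ t(2)] flag3[OF tri_perm(1)[OF t(1)] _ tri_perm(1)[OF t(2)]] by blast
  ultimately show ?thesis by blast
qed

lemma hadj_inj:
  assumes x: "x \<in> level (Suc n)" and y: "y \<in> level (Suc n)" and y': "y' \<in> level (Suc n)"
    and h: "hadj x y" "hadj x y'" and l: "lab y = lab y'"
  shows "y = y'"
proof -
  obtain p where p: "p \<in> below x" "p \<in> below y"
    using h by (auto simp: hadj_def)
  have "tri X (lab p) (lab x) (lab y')"
    using below_iff_tri[OF x y h(1)] p l by auto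
  then have "p \<in> below y'"
    using below_iff_tri[OF x y' h(2)] p by blast
  then show ?thesis using level_eqI y y' l p by blast
qed

text \<open>With a lower neighbour common to all three points, flagness decides. Without one both
  sides fail: either of them would produce a 4-cycle in a link, every diagonal of which creates such
  a common lower neighbour.\<close>

lemma hadj_tri':
  assumes x: "x \<in> level (Suc n)" and y: "y \<in> level (Suc n)" and y': "y' \<in> level (Suc n)"
    and h: "hadj x y" "hadj x y'" and ne: "y \<noteq> y'"
  shows "hadj y y' \<longleftrightarrow> tri X (lab x) (lab y) (lab y')"
proof (cases "below x \<inter> below y \<inter> below y' = {}")
  case False
  then show ?thesis
    using hadj_hadj_common[OF x y y' h] by blast
next
  case True
  obtain p1 where p1: "p1 \<in> below x" "p1 \<in> below y" "tri X (lab p1) (lab x) (lab y)"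
    using h by (auto simp: hadj_def)
  obtain p2 where p2: "p2 \<in> below x" "p2 \<in> below y'" "tri X (lab p2) (lab x) (lab y')"
    using h by (auto simp: hadj_def)
  have p: "p1 \<noteq> p2"
    using True p1 p2 by blast
  have pt: "hadj p1 p2" "tri X (lab p1) (lab p2) (lab x)"
    using below_clique'[OF x] p1 p2 p by blast+
  have L: "p1 \<in> level n" "p2 \<in> level n"
    using p1 p2 x below_level_Suc by blast+
  have "\<not> tri X (lab x) (lab y) (lab y')"
  proof
    assume t: "tri X (lab x) (lab y) (lab y')"
    have "lab p1 \<noteq> lab y'" "lab y \<noteq> lab p2"
      using below_lab_ne[OF x] p1 p2 y y' by metis+
    \<comment> \<open>The 4-cycle \<open>p1, y, y', p2\<close> in the link of
      \<open>lab x\<close>.\<close>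
    then have "tri X (lab x) (lab p1) (lab y') \<or> tri X (lab x) (lab y) (lab p2)"
      using link4[OF tri_perm(1)[OF p1(3)] t tri_perm(3)[OF p2(3)] tri_perm(5)[OF pt(2)]] by blast
    then show False
      using below_iff_tri[OF x y h(1) p2(1)] below_iff_tri[OF x y' h(2) p1(1)] p1 p2 True
        tri_perm(1)[of X "lab x" "lab p1" "lab y'"] tri_perm(4)[of X "lab x" "lab y" "lab p2"] by blast
  qed
  moreover have "\<not> hadj y y'"
  proof
    assume "hadj y y'"
    then obtain q where q: "q \<in> below y" "q \<in> below y'" "tri X (lab q) (lab y) (lab y')"
      by (auto simp: hadj_def)
    have qL: "q \<in> level n" using q y below_level_Suc by blast
    have ne: "q \<noteq> p1" "q \<noteq> p2" using True p1 p2 q by blast+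
    have q1: "hadj p1 q" "tri X (lab p1) (lab q) (lab y)"
      using below_clique'[OF y] p1 q ne by blast+
    have q2: "hadj p2 q" "tri X (lab p2) (lab q) (lab y')"
      using below_clique'[OF y'] p2 q ne by blast+
    have t: "tri X (lab p1) (lab p2) (lab q)"
      using hadj_tri[OF L(1,2) qL hadj_sym[OF pt(1)] hadj_sym[OF q1(1)] ne(2)[symmetric]] q2 by blast
    have "lab p2 \<noteq> lab y" "lab x \<noteq> lab q"
      using below_lab_ne[OF x p2(1) p1(1,2) y] below_lab_ne[OF y q(1) p1(2,1) x] by metis+
    \<comment> \<open>The 4-cycle \<open>p2, x, y, q\<close> in the link of \<open>lab p1\<close>,
      closed up because \<open>p2\<close> and \<open>q\<close> both lie below
      \<open>y'\<close>.\<close>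
    then have "tri X (lab p1) (lab p2) (lab y) \<or> tri X (lab p1) (lab x) (lab q)"
      using link4[OF pt(2) p1(3) tri_perm(2)[OF q1(2)] tri_perm(2)[OF t]] by blast
    then have "p2 \<in> below y \<or> q \<in> below x"
      using below_memI[OF y p1(2) L(2)] below_memI[OF x p1(1) qL] hadj_sym[OF pt(1)] hadj_sym[OF q1(1)]
        tri_perm(1)[of X "lab p1" "lab p2" "lab y"] tri_perm(4)[of X "lab p1" "lab x" "lab q"] by blast
    then show False using True p2 q by blast
  qed
  ultimately show ?thesis by blast
qed

lemma up_hadj:
  assumes x: "x \<in> level n" and y: "y \<in> level (Suc n)" and y': "y' \<in> level (Suc n)"
    and u: "x \<in> below y" "x \<in> below y'"
  shows "hadj y y' \<longleftrightarrow> tri X (lab x) (lab y) (lab y')"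
  using below_iff_tri[OF y y' _ u(1)] u by (auto simp: hadj_def)

text \<open>The critical case is a lower neighbour of \<open>x\<close> against an upper one: they
  are two levels apart, hence not adjacent, and their labels form no triangle with that of
  \<open>x\<close> because the upper label was fresh.\<close>

lemma star_mixed:
  assumes x: "x \<in> level n" and y: "y \<in> nb (level n) x" and y': "y' \<in> level (Suc n)" "x \<in> below y'"
  shows "adj y y' \<longleftrightarrow> tri X (lab x) (lab y) (lab y')"
  using x y
proof (cases rule: nb_levelE)
  case 1
  note True = 1(1) and h = 1(2)
  have "y \<noteq> x" using h by (auto simp: hadj_def tri_def)
  then have "y \<in> below y' \<longleftrightarrow> tri X (lab x) (lab y) (lab y')"
    using below_memI[OF y' True h] below_clique'(2)[OF y'(1) y'(2), of y] tri_perm(1)[of X "lab x" "lab y" "lab y'"] by blast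
  then show ?thesis using adj_up[OF True y'(1)] by blast
next
  case (2 k)
  note k = 2(1,2) and p = 2(3)
  then have "\<not> adj y y'"
    using adj_level[OF k(2) y'(1)] by auto
  then show ?thesis
    using fresh_not_tri[OF below_fresh(1)[OF y'] p] by blast
qed

lemma coherent_Suc: "coherent (Suc n)"
  unfolding coherent_def
proof (intro ballI conjI allI impI)
  fix x assume x: "x \<in> level (Suc n)"
  let ?N = "nb (level (Suc n)) x"
  have N: "y \<in> below x \<and> y \<in> level n \<or> y \<in> level (Suc n) \<and> hadj x y" if "y \<in> ?N" for y
    using that below_level_Suc[OF x] hadj_sym[of y x] unfolding nb_def by blast
  have mixed_lab: "lab w \<noteq> lab y" if "w \<in> below x" "y \<in> level (Suc n)" "hadj x y" for w y
    using that below_lab_ne[OF x] by (auto simp: hadj_def)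
  show "inj_on lab ?N"
  proof (rule inj_onI)
    fix y y' assume y: "y \<in> ?N" and y': "y' \<in> ?N" and l: "lab y = lab y'"
    show "y = y'"
      using N[OF y] N[OF y'] mixed_lab[of y y'] mixed_lab[of y' y] l hadj_inj[OF x, of y y']
        below_clique'(2)[OF x, of y y'] unfolding tri_def by auto
  qed
  show "hadj w w'" if "w \<in> below x" "w' \<in> below x" "w \<noteq> w'" for w w'
    using that below_clique' x by blast
  show "adj y y' = tri X (lab x) (lab y) (lab y')" if y: "y \<in> ?N" and y': "y' \<in> ?N" and ne: "y \<noteq> y'" for y y'
  proof -
    have mixed: "adj w z \<longleftrightarrow> tri X (lab x) (lab w) (lab z)" if "w \<in> below x" "w \<in> level n" "z \<in> level (Suc n)" "hadj x z" for w z
      using that below_iff_tri[OF x, of z w] adj_up[of w n z] tri_perm(1)[of X "lab x" "lab w" "lab z"]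
        tri_perm(1)[of X "lab w" "lab x" "lab z"] by blast
    consider "y \<in> below x" "y' \<in> below x" | "y \<in> below x" "y \<in> level n" "y' \<in> level (Suc n)" "hadj x y'"
      | "y' \<in> below x" "y' \<in> level n" "y \<in> level (Suc n)" "hadj x y"
      | "y \<in> level (Suc n)" "hadj x y" "y' \<in> level (Suc n)" "hadj x y'"
      using N[OF y] N[OF y'] by blast
    then show ?thesis
    proof cases
      case 1
      then show ?thesis using below_clique'[OF x, of y y'] ne tri_perm(4)[of X "lab y" "lab y'" "lab x"] unfolding adj_def by blast
    next
      case 2
      then show ?thesis using mixed by blast
    next
      case 3
      then show ?thesis using mixed[of y' y] adj_sym[of y y'] adj_sym[of y' y] tri_perm(2)[of X "lab x" "lab y" "lab y'"]
        tri_perm(2)[of X "lab x" "lab y'" "lab y"] by blast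
    next
      case 4
      then show ?thesis using hadj_tri'[OF x, of y y'] ne adj_same by blast
    qed
  qed
  \<comment> \<open>If \<open>z\<close> already occurs in the star of \<open>p\<close>, the triangle
    places its carrier below \<open>x\<close>. Otherwise \<open>z\<close> is fresh at
    \<open>p\<close>, and the vertex added over it in the new level is horizontally adjacent to
    \<open>x\<close>.\<close>
  show "z \<in> lab ` ?N" if p: "p \<in> below x" and t: "tri X (lab x) (lab p) z" for p z
  proof (cases "z \<in> lab ` nb (level n) p")
    case True
    then obtain y where y: "y \<in> nb (level n) p" "z = lab y" by blast
    have pL: "p \<in> level n" using p x below_level_Suc by blast
    then have "adj y x"
      using star_mixed[OF pL y(1) x p] t y tri_perm(3)[of X "lab x" "lab p" z] by simp
    have "y \<in> below x"
      using pL y(1)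
    proof (cases rule: nb_levelE)
      case 1
      then show ?thesis using adj_up[OF _ x] \<open>adj y x\<close> by blast
    next
      case (2 k)
      then show ?thesis using adj_level[OF 2(2) x \<open>adj y x\<close>] by simp
    qed
    then show ?thesis using y unfolding nb_def by blast
  next
    case False
    then have fresh: "fresh (level n) p z"
      using p t x below_level_Suc tri_edg unfolding fresh_def by blast
    obtain y where y: "y \<in> level (Suc n)" "lab y = z" "below y = fibre (level n) p z"
      using fresh_ex[OF fresh] by blast
    then have "p \<in> below y" by (auto simp: fibre_def)
    then have "hadj y x"
      using p t y tri_perm(3)[OF t] unfolding hadj_def by blast
    then show ?thesis using y unfolding nb_def by blast
  qed
qed

end

lemma coherent_all: "coherent n"
  by (induction n) (simp_all add: coherent_0 coherent_Suc)

section \<open>The covering map and its injectivity\<close>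

definition V :: "'a cov set" where "V = (\<Union>n. level n)"

lemma adj_cases:
  assumes "x \<in> level n" "y \<in> V" "adj x y"
  shows "y \<in> nb (level n) x \<or> y \<in> level (Suc n) \<and> x \<in> below y"
proof -
  obtain m where m: "y \<in> level m" using assms by (auto simp: V_def)
  show ?thesis
    using adj_level[OF assms(1) m assms(3)]
    using assms m adj_same[of x n y] adj_up[of x n y] adj_up[of y m x] adj_sym[of x y] hadj_sym[of x y] unfolding nb_def by blast
qed

lemma adj_edg:
  assumes "x \<in> V" "y \<in> V" "adj x y" shows "edg X (lab x) (lab y)"
  using assms hadj_edg[of x y] below_edg[of y _ x] below_edg[of x _ y] edg_sym[of X "lab y" "lab x"] unfolding adj_def V_def by blast

text \<open>Upper neighbours of \<open>x\<close> carry labels fresh at \<open>x\<close>, so they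
  cannot clash with the earlier ones, and among themselves they are determined by label and lower
  neighbour. With \<open>cov_tri\<close> and \<open>cov_surj\<close> this makes \<open>lab\<close>
  an isomorphism on each star.\<close>

lemma cov_inj:
  assumes "x \<in> V" "y \<in> V" "y' \<in> V" "adj x y" "adj x y'" "lab y = lab y'"
  shows "y = y'"
proof -
  obtain n where n: "x \<in> level n" using assms by (auto simp: V_def)
  have up: "lab z \<notin> lab ` nb (level n) x" if "z \<in> level (Suc n)" "x \<in> below z" for z
    using below_fresh[OF coherent_all that] by (auto simp: fresh_def)
  show ?thesis
    using adj_cases[OF n assms(2,4)] adj_cases[OF n assms(3,5)] assms(6)
      up[of y] up[of y'] inj_nb[OF coherent_all n] level_eqI[OF coherent_all, of y n y' x]
    by (metis imageI)
qed

lemma cov_tri: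
  assumes "x \<in> V" "y \<in> V" "y' \<in> V" "adj x y" "adj x y'" "y \<noteq> y'"
  shows "adj y y' \<longleftrightarrow> tri X (lab x) (lab y) (lab y')"
proof -
  obtain n where n: "x \<in> level n" using assms by (auto simp: V_def)
  consider "y \<in> nb (level n) x" "y' \<in> nb (level n) x" | "y \<in> nb (level n) x" "y' \<in> level (Suc n)" "x \<in> below y'"
    | "y' \<in> nb (level n) x" "y \<in> level (Suc n)" "x \<in> below y"
    | "y \<in> level (Suc n)" "x \<in> below y" "y' \<in> level (Suc n)" "x \<in> below y'"
    using adj_cases[OF n assms(2,4)] adj_cases[OF n assms(3,5)] by blast
  then show ?thesis
  proof cases
    case 1
    then show ?thesis using adj_nb[OF coherent_all n] assms by blast
  next
    case 2
    then show ?thesis using star_mixed[OF coherent_all n] by blast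
  next
    case 3
    then show ?thesis using star_mixed[OF coherent_all n, of y' y] adj_sym[of y y'] adj_sym[of y' y] tri_perm(2)[of X "lab x" "lab y" "lab y'"]
        tri_perm(2)[of X "lab x" "lab y'" "lab y"] by blast
  next
    case 4
    then show ?thesis using up_hadj[OF coherent_all n, of y y'] adj_same assms by blast
  qed
qed

lemma cov_surj:
  assumes "x \<in> V" "edg X (lab x) z"
  shows "\<exists>y \<in> V. adj x y \<and> lab y = z"
proof -
  obtain n where n: "x \<in> level n" using assms by (auto simp: V_def)
  show ?thesis
  proof (cases "z \<in> lab ` nb (level n) x")
    case True
    then obtain y where y: "y \<in> nb (level n) x" "z = lab y" by blast
    have "y \<in> V"
      by (rule nb_levelE[OF n y(1)]) (auto simp: V_def simp del: level.simps)
    moreover have "adj x y"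
      using y hadj_sym[of y x] unfolding nb_def adj_def by blast
    ultimately show ?thesis using y by blast
  next
    case False
    then have "fresh (level n) x z" using n assms by (auto simp: fresh_def)
    then obtain y where y: "y \<in> level (Suc n)" "lab y = z" "below y = fibre (level n) x z"
      using fresh_ex[OF coherent_all] by blast
    then have "x \<in> below y" by (auto simp: fibre_def)
    then show ?thesis using y unfolding V_def adj_def by blast
  qed
qed

end

context locally_6_large_complex
begin

text \<open>By \<open>cov_surj\<close> and \<open>cov_inj\<close> the chosen neighbour exists and is
  unique whenever \<open>v\<close> is adjacent to \<open>lab x\<close>.\<close>

definition tr :: "'a cov \<Rightarrow> 'a \<Rightarrow> 'a cov" where
  "tr x v = (if v = lab x then x else SOME y. y \<in> V \<and> adj x y \<and> lab y = v)"

lemma tr_neighbour: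
  assumes "x \<in> V" "y \<in> V" "adj x y"
  shows "tr x (lab y) = y"
proof -
  have "lab y \<noteq> lab x"
    using adj_edg[OF assms] by (auto simp: edg_def)
  moreover have "(SOME y'. y' \<in> V \<and> adj x y' \<and> lab y' = lab y) = y"
    by (rule some_equality) (use assms cov_inj in blast)+
  ultimately show ?thesis
    by (simp add: tr_def)
qed

lemma tr_cases:
  assumes "x \<in> V" "{lab x, v} \<in> X"
  obtains "v = lab x" "tr x v = x" | y where "y \<in> V" "adj x y" "lab y = v" "tr x v = y"
proof (cases "v = lab x")
  case True
  then show ?thesis using that by (simp add: tr_def)
next
  case False
  then have "edg X (lab x) v"
    using assms by (auto simp: edg_def)
  then obtain y where "y \<in> V" "adj x y" "lab y = v"
    using cov_surj assms by blast
  then show ?thesis using that tr_neighbour[OF assms(1)] by blast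
qed

lemma lifting_tr: "lifting X V lab tr"
proof
  show "simp_complex X" by (fact cx)
  show "tr x v \<in> V \<and> lab (tr x v) = v" if "x \<in> V" "{lab x, v} \<in> X" for x v
    using tr_cases[OF that] that by metis
  show tr_id: "tr x (lab x) = x" for x
    by (simp add: tr_def)
  show "tr (tr x v) w = tr x w" if x: "x \<in> V" and t: "{lab x, v, w} \<in> X" for x v w
  proof -
    have "{lab x, v} \<in> X" "{lab x, w} \<in> X"
      by (rule subsimplex[OF t]; force)+
    note v = tr_cases[OF x this(1)] and w = tr_cases[OF x this(2)]
    show ?thesis
    proof (cases "v = lab x \<or> w = v")
      case True
      then show ?thesis using v tr_id by metis
    next
      case False
      then obtain y where y: "y \<in> V" "adj x y" "lab y = v" "tr x v = y"
        using v by metis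
      show ?thesis
      proof (cases "w = lab x")
        case True
        then show ?thesis
          using tr_neighbour[OF y(1) x adj_sym[OF y(2)]] y tr_id by simp
      next
        case w_ne: False
        then obtain z where z: "z \<in> V" "adj x z" "lab z = w" "tr x w = z"
          using w by metis
        have "tri X (lab x) (lab y) (lab z)"
          unfolding tri_def y(3) z(3) using t False w_ne by auto
        moreover have "y \<noteq> z"
          using y(3) z(3) False by blast
        ultimately have "adj y z"
          using cov_tri[OF x y(1) z(1) y(2) z(2)] by blast
        then show ?thesis
          using tr_neighbour[OF y(1) z(1)] y z by simp
      qed
    qed
  qed
qed

lemma level_V: "x \<in> level n \<Longrightarrow> x \<in> V"
  unfolding V_def by blast

abbreviation root :: "'a cov" where
  "root \<equiv> Cov v0 {||}"

lemma root_V: "root \<in> V"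
  by (rule level_V[of _ 0]) simp

lemma connected_to_root:
  assumes "x \<in> level n"
  shows "(x, root) \<in> {(x, y). x \<in> V \<and> y \<in> V \<and> adj x y}\<^sup>*"
  using assms
proof (induction n arbitrary: x)
  case (Suc n)
  obtain w where w: "w \<in> below x"
    using below_ne[OF Suc.prems] by blast
  then have "w \<in> level n"
    using below_level_Suc[OF Suc.prems] by blast
  moreover have "adj x w"
    using w by (simp add: adj_def)
  ultimately show ?case
    using Suc.IH[of w] level_V Suc.prems by (auto intro: converse_rtrancl_into_rtrancl)
qed simp

text \<open>Two points over one label are joined through the root by a path of the cover. It is the
  lift of a closed walk, hence closed itself.\<close>

lemma lab_inj:
  assumes sc: "simply_connected_space (realization X)"
    and xy: "x \<in> V" "x' \<in> V" "lab x = lab x'"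
  shows "x = x'"
proof -
  interpret lifting X V lab tr by (rule lifting_tr)
  define R where "R = {(x, y). x \<in> V \<and> y \<in> V \<and> adj x y}"
  have "sym R"
    using adj_sym by (auto simp: sym_def R_def)
  then have "sym (R\<^sup>*)"
    by (rule sym_rtrancl)
  moreover have "(z, root) \<in> R\<^sup>*" if "z \<in> V" for z
    using that connected_to_root unfolding V_def R_def by blast
  ultimately have "(root, x) \<in> R\<^sup>*" "(x', root) \<in> R\<^sup>*"
    using xy(1,2) symD by metis+
  then have "(x', x) \<in> R\<^sup>*"
    by (metis rtrancl_trans)
  then obtain m where "(x', x) \<in> R ^^ m"
    using rtrancl_imp_relpow by metis
  then obtain y where y: "y 0 = x'" "y m = x" "\<And>k. k < m \<Longrightarrow> (y k, y (Suc k)) \<in> R"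
    unfolding relpow_fun_conv by metis
  have "y m = y 0"
  proof (rule closed_walk_lifts_closed[OF sc])
    show "{lab (y k), lab (y (Suc k))} \<in> X \<and> y (Suc k) = tr (y k) (lab (y (Suc k)))" if "k < m" for k
      using y(3)[OF that] adj_edg tr_neighbour by (auto simp: edg_def R_def)
  qed (use y xy in simp_all)
  then show ?thesis
    using y by simp
qed

end

section \<open>The projection\<close>

locale systolic_complex = locally_6_large_complex +
  assumes v0: "v0 \<in> vertices X"
    and conn: "connected_space (realization X)" and sc: "simply_connected_space (realization X)"
begin

section \<open>Levels are the spheres around \<open>v0\<close>\<close>

lemma lab_surj:
  assumes "v \<in> vertices X"
  shows "\<exists>x \<in> V. lab x = v"
proof -
  have "v \<in> lab ` V"
  proof (rule connected_space_vertices[OF cx conn _ v0 _ assms])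
    show "v0 \<in> lab ` V"
      using root_V by force
    show "b \<in> lab ` V" if "a \<in> lab ` V" "edg X a b" for a b
      using that cov_surj by blast
  qed
  then show ?thesis by blast
qed

lemma adj_iff_edg:
  assumes "x \<in> V" "y \<in> V"
  shows "adj x y \<longleftrightarrow> edg X (lab x) (lab y)"
  using assms adj_edg cov_surj lab_inj[OF sc] by metis

lemma path_to_root: "x \<in> level n \<Longrightarrow> (lab x, v0) \<in> edge_rel X ^^ n"
proof (induction n arbitrary: x)
  case (Suc n)
  obtain w where w: "w \<in> below x"
    using below_ne[OF Suc.prems] by blast
  have "(lab x, lab w) \<in> edge_rel X"
    using below_edg[OF Suc.prems w] by (auto simp: edg_def edge_rel_def insert_commute)
  moreover have "(lab w, v0) \<in> edge_rel X ^^ n"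
    using Suc.IH below_level_Suc[OF Suc.prems] w by blast
  ultimately show ?case
    by (rule relpow_Suc_I2)
qed simp

text \<open>An edge path lifts step by step to the cover, and each step changes the level by at most
  one. Injectivity of \<open>lab\<close> identifies the end of the lift with
  \<open>y\<close>.\<close>

lemma level_path_le:
  "x \<in> level n \<Longrightarrow> y \<in> level k \<Longrightarrow> (lab x, lab y) \<in> edge_rel X ^^ m \<Longrightarrow> n \<le> k + m"
proof (induction m arbitrary: x n)
  case 0
  then have "x = y"
    using lab_inj[OF sc] level_V by simp
  then show ?case
    using level_unique[of x n k] 0 by simp
next
  case (Suc m)
  obtain b where b: "(lab x, b) \<in> edge_rel X" "(b, lab y) \<in> edge_rel X ^^ m"
    using Suc.prems(3) by (rule relpow_Suc_E2)
  then have "edg X (lab x) b"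
    by (auto simp: edge_rel_def edg_def)
  then obtain z where z: "z \<in> V" "adj x z" "lab z = b"
    using cov_surj level_V Suc.prems(1) by blast
  then obtain n' where n': "z \<in> level n'"
    unfolding V_def by blast
  have "n' \<le> k + m"
    using Suc.IH[OF n' Suc.prems(2)] b z by simp
  then show ?case
    using adj_level[OF Suc.prems(1) n' z(2)] by linarith
qed

lemma edge_dist_level:
  assumes "x \<in> level n"
  shows "edge_dist X (lab x) v0 = enat n"
  unfolding edge_dist_def
proof (rule antisym)
  show "(INF m\<in>{m. (lab x, v0) \<in> edge_rel X ^^ m}. enat m) \<le> enat n"
    using path_to_root[OF assms] by (intro INF_lower) simp
  show "enat n \<le> (INF m\<in>{m. (lab x, v0) \<in> edge_rel X ^^ m}. enat m)"
    using level_path_le[OF assms, of root 0] by (intro INF_greatest) simp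
qed

lemma sphere_vertices: "{v \<in> vertices X. edge_dist X v v0 = enat n} = lab ` level n"
proof (intro subset_antisym subsetI)
  fix v assume v: "v \<in> {v \<in> vertices X. edge_dist X v v0 = enat n}"
  then obtain x m where "x \<in> level m" "lab x = v"
    using lab_surj unfolding V_def by blast
  then show "v \<in> lab ` level n"
    using edge_dist_level v by fastforce
next
  have "lab x \<in> vertices X" if x: "x \<in> level n" for x
  proof (cases n)
    case 0
    then show ?thesis using x v0 by simp
  next
    case (Suc k)
    then obtain w where "w \<in> below x"
      using below_ne[of x k] x by blast
    then have "{lab w, lab x} \<in> X"
      using below_edg[OF x] by (simp add: edg_def)
    then show ?thesis
      by (auto simp: vertices_def)
  qed
  then show "v \<in> {v \<in> vertices X. edge_dist X v v0 = enat n}" if "v \<in> lab ` level n" for v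
    using that edge_dist_level by auto
qed

section \<open>The projection of one simplex, lifted to \<open>S\<close>\<close>

context
  fixes n :: nat and S :: "'a cov set"
  assumes S: "S \<subseteq> level (Suc n)" and simplex: "lab ` S \<in> X"
begin

lemma simplex_hadj:
  assumes "x \<in> S" "y \<in> S" "x \<noteq> y"
  shows "hadj x y"
proof -
  have "lab x \<noteq> lab y"
    using lab_inj[OF sc] level_V assms S by blast
  then have "edg X (lab x) (lab y)"
    using subsimplex[OF simplex, of "{lab x, lab y}"] assms by (auto simp: edg_def)
  then show ?thesis
    using adj_iff_edg level_V adj_same assms S by blast
qed

lemma simplex_tri:
  assumes "x \<in> S" "y \<in> S" "z \<in> S" "x \<noteq> y" "y \<noteq> z" "x \<noteq> z"
  shows "tri X (lab x) (lab y) (lab z)"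
proof -
  have "lab a \<noteq> lab b" if "a \<in> S" "b \<in> S" "a \<noteq> b" for a b
    using lab_inj[OF sc] level_V that S by blast
  then show ?thesis
    using subsimplex[OF simplex, of "{lab x, lab y, lab z}"] assms by (auto simp: tri_def)
qed

lemma common_below: "\<exists>w. \<forall>x \<in> S. w \<in> below x"
proof -
  have "finite (lab ` S)" "S \<noteq> {}"
    using simplex cx unfolding simp_complex_def by auto
  moreover have "inj_on lab S"
    using lab_inj[OF sc] level_V S by (blast intro: inj_onI)
  ultimately have fin: "finite S"
    using finite_imageD by blast
  \<comment> \<open>The number of vertices of the simplex above \<open>w\<close>. It is bounded by
    \<open>card S\<close>, so a maximal \<open>w\<close> exists however many candidates there
    are.\<close>
  let ?f = "\<lambda>w. card {x \<in> S. w \<in> below x}"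
  obtain x0 where x0: "x0 \<in> S"
    using \<open>S \<noteq> {}\<close> by blast
  then obtain w0 where "w0 \<in> below x0"
    using below_ne S by blast
  then have "\<exists>x\<in>S. w0 \<in> below x"
    using x0 by blast
  moreover have "\<forall>w. (\<exists>x\<in>S. w \<in> below x) \<longrightarrow> ?f w < Suc (card S)"
    using card_mono[OF fin] by (simp add: less_Suc_eq_le)
  ultimately have "\<exists>w. (\<exists>x\<in>S. w \<in> below x) \<and> (\<forall>w'. (\<exists>x\<in>S. w' \<in> below x) \<longrightarrow> ?f w' \<le> ?f w)"
    by (rule ex_has_greatest_nat)
  then obtain w where W: "(\<exists>x\<in>S. w \<in> below x) \<and> (\<forall>w'. (\<exists>x\<in>S. w' \<in> below x) \<longrightarrow> ?f w' \<le> ?f w)"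
    by (rule exE)
  then have w: "\<exists>x\<in>S. w \<in> below x" and max: "\<And>w'. \<exists>x\<in>S. w' \<in> below x \<Longrightarrow> ?f w' \<le> ?f w"
    by blast+
  have "w \<in> below y" if y: "y \<in> S" for y
  proof (rule ccontr)
    assume wy: "w \<notin> below y"
    obtain x where x: "x \<in> S" "w \<in> below x"
      using w by blast
    have h: "hadj x y"
      using simplex_hadj x y wy by blast
    then obtain w' where w': "w' \<in> below x" "w' \<in> below y"
      by (auto simp: hadj_def)
    have L: "x \<in> level (Suc n)" "y \<in> level (Suc n)"
      using x y S by blast+
    have ww: "w \<noteq> w'"
      using w' wy by blast
    \<comment> \<open>The link of \<open>lab x\<close> contains the 4-cycle
      \<open>w, z, y, w'\<close>. Its diagonal from \<open>w\<close> to \<open>y\<close> would put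
      \<open>w\<close> below \<open>y\<close>; the other one puts \<open>w'\<close> below
      \<open>z\<close>. So \<open>w'\<close> lies below everything that \<open>w\<close> does and
      also below \<open>y\<close>.\<close>
    have "w' \<in> below z" if z: "z \<in> S" "w \<in> below z" for z
    proof (cases "z = x")
      case False
      have zL: "z \<in> level (Suc n)" and zy: "z \<noteq> y" and hz: "hadj x z"
        using z S wy simplex_hadj x False by blast+
      have "tri X (lab x) (lab w) (lab z)"
        by (rule tri_perm(1)[OF iffD1[OF below_iff_tri[OF coherent_all L(1) zL hz x(2)] z(2)]])
      moreover have "tri X (lab x) (lab z) (lab y)"
        by (rule simplex_tri) (use x z y False zy wy in auto)
      moreover have "tri X (lab x) (lab y) (lab w')"
        by (rule tri_perm(3)[OF iffD1[OF below_iff_tri[OF coherent_all L h w'(1)] w'(2)]])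
      moreover have "tri X (lab x) (lab w') (lab w)"
        by (rule tri_perm(5)[OF below_clique'(2)[OF coherent_all L(1) x(2) w'(1) ww]])
      moreover have "lab w \<noteq> lab y"
        using below_lab_ne[OF coherent_all L(1) x(2) w' L(2)] .
      moreover have "lab z \<noteq> lab w'"
        using below_lab_ne[OF coherent_all L(1) w'(1) x(2) z(2) zL] by metis
      ultimately have "tri X (lab x) (lab w) (lab y) \<or> tri X (lab x) (lab z) (lab w')"
        by (rule link4)
      then have "tri X (lab w) (lab x) (lab y) \<or> tri X (lab w') (lab x) (lab z)"
        by (metis tri_perm(1) tri_perm(4))
      then show ?thesis
        using below_iff_tri[OF coherent_all L h x(2)] below_iff_tri[OF coherent_all L(1) zL hz w'(1)] wy by blast
    qed (use w' in simp)
    then have "{z \<in> S. w \<in> below z} \<subset> {z \<in> S. w' \<in> below z}"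
      using y wy w' by blast
    then have "?f w < ?f w'"
      using fin by (intro psubset_card_mono) auto
    moreover have "?f w' \<le> ?f w"
      using max y w' by blast
    ultimately show False by simp
  qed
  then show ?thesis by blast
qed

lemma projection_simplex: "lab ` (\<Inter>x\<in>S. below x) \<in> X"
proof -
  obtain x where x: "x \<in> S"
    using simplex cx unfolding simp_complex_def by (metis ex_in_conv image_is_empty)
  then have xL: "x \<in> level (Suc n)"
    using S by blast
  let ?T = "\<Inter>x\<in>S. below x"
  have ne: "lab ` ?T \<noteq> {}"
    using common_below by blast
  have "insert (lab x) (lab ` ?T) \<in> X"
  proof (rule link_flag[OF ne])
    show "edg X (lab x) a" if a: "a \<in> lab ` ?T" for a
    proof -
      obtain p where p: "p \<in> below x" "a = lab p"
        using a x by blast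
      show ?thesis
        unfolding p(2) by (rule edg_sym[OF below_edg[OF xL p(1)]])
    qed
    show "tri X (lab x) a b" if ab: "a \<in> lab ` ?T" "b \<in> lab ` ?T" "a \<noteq> b" for a b
    proof -
      obtain p q where pq: "p \<in> below x" "q \<in> below x" "a = lab p" "b = lab q"
        using ab(1,2) x by blast
      then have "p \<noteq> q"
        using ab(3) by blast
      then show ?thesis
        unfolding pq(3,4) by (rule tri_perm(4)[OF below_clique'(2)[OF coherent_all xL pq(1,2)]])
    qed
  qed
  then show ?thesis
    by (rule subsimplex) (use ne in auto)
qed

text \<open>A vertex of level \<open>n\<close> in a simplex containing the given one is adjacent to
  all of \<open>S\<close>, which across consecutive levels means lying below. Conversely, for a
  point below all of \<open>S\<close>, flagness of its link fills in the join with the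
  simplex.\<close>

lemma projection_vertices:
  "\<Union>{t \<in> X. lab ` S \<subseteq> t} \<inter> lab ` level n = lab ` (\<Inter>x\<in>S. below x)"
proof (intro subset_antisym subsetI)
  fix v assume "v \<in> \<Union>{t \<in> X. lab ` S \<subseteq> t} \<inter> lab ` level n"
  then obtain t w where t: "t \<in> X" "lab ` S \<subseteq> t" "v \<in> t" and w: "w \<in> level n" "v = lab w"
    by blast
  have "w \<in> below x" if x: "x \<in> S" for x
  proof -
    have xL: "x \<in> level (Suc n)"
      using x S by blast
    then have "w \<noteq> x"
      using level_unique w by (metis n_not_Suc_n)
    then have "lab w \<noteq> lab x"
      using lab_inj[OF sc] level_V w(1) xL by blast
    then have "edg X (lab w) (lab x)"
      using subsimplex[OF t(1), of "{lab w, lab x}"] t w x by (auto simp: edg_def)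
    then show ?thesis
      using adj_iff_edg adj_up w(1) xL level_V by blast
  qed
  then show "v \<in> lab ` (\<Inter>x\<in>S. below x)"
    using w by blast
next
  fix v assume "v \<in> lab ` (\<Inter>x\<in>S. below x)"
  then obtain w where w: "v = lab w" "\<And>x. x \<in> S \<Longrightarrow> w \<in> below x"
    by blast
  have ne: "lab ` S \<noteq> {}"
    using simplex cx unfolding simp_complex_def by blast
  then have "w \<in> level n"
    using w S below_level_Suc by blast
  have "insert v (lab ` S) \<in> X"
  proof (rule link_flag[OF ne])
    show "edg X v a" if "a \<in> lab ` S" for a
      using that w S below_edg by blast
    show "tri X v a b" if ab: "a \<in> lab ` S" "b \<in> lab ` S" "a \<noteq> b" for a b
    proof -
      obtain x y where xy: "x \<in> S" "y \<in> S" "a = lab x" "b = lab y"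
        using ab by blast
      then have "hadj x y"
        using simplex_hadj ab(3) by blast
      then show ?thesis
        using below_iff_tri[OF coherent_all, of x n y w] xy w S by blast
    qed
  qed
  then show "v \<in> \<Union>{t \<in> X. lab ` S \<subseteq> t} \<inter> lab ` level n"
    using w(1) \<open>w \<in> level n\<close> by blast
qed

end

theorem residue_sphere_simplex:
  assumes "\<sigma> \<in> cx_sphere X v0 (Suc n)"
  shows "\<exists>\<tau>\<in>X. cx_residue X \<sigma> \<inter> cx_sphere X v0 n = full_simplex \<tau>"
proof -
  have \<sigma>: "\<sigma> \<in> X" "\<sigma> \<subseteq> lab ` level (Suc n)"
    using assms unfolding cx_sphere_def sphere_vertices cx_span_def by blast+
  then obtain S where S: "S \<subseteq> level (Suc n)" "\<sigma> = lab ` S"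
    by (metis subset_imageE)
  let ?\<tau> = "lab ` (\<Inter>x\<in>S. below x)"
  have \<tau>: "?\<tau> \<in> X"
    using projection_simplex S \<sigma> by blast
  have "cx_residue X \<sigma> \<inter> cx_sphere X v0 n = {s \<in> X. s \<subseteq> \<Union>{t \<in> X. \<sigma> \<subseteq> t} \<inter> lab ` level n}"
    unfolding cx_residue_def cx_sphere_def sphere_vertices cx_span_def by blast
  also have "\<dots> = {s \<in> X. s \<subseteq> ?\<tau>}"
    using projection_vertices S \<sigma> by simp
  also have "\<dots> = full_simplex ?\<tau>"
    using subsimplex[OF \<tau>] cx unfolding full_simplex_def simp_complex_def by blast
  finally show ?thesis
    using \<tau> by blast
qed

end

text \<open>Edges of the link of \<open>v\<close> are triangles at \<open>v\<close>. Any edge or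
  triangle at \<open>v\<close> shows that \<open>v\<close> is a vertex, so that its link is known to
  be 6-large.\<close>

lemma systolic_imp_locally_6_large_complex:
  assumes "systolic X"
  shows "locally_6_large_complex X"
proof
  have K: "simp_complex X" and large: "\<And>v. v \<in> vertices X \<Longrightarrow> k_large 6 (cx_link X v)"
    using assms by (auto simp: k_systolic_def locally_k_large_def)
  show "simp_complex X"
    by (fact K)
  have large': "k_large 6 (cx_link X v)" if "edg X v a" for v a
    by (rule large) (use that in \<open>auto simp: vertices_def edg_def\<close>)
  have large'': "k_large 6 (cx_link X v)" if "tri X v a b" for v a b
    by (rule large) (use that in \<open>auto simp: vertices_def tri_def\<close>)
  show "insert v A \<in> X"
    if A: "A \<noteq> {}" "\<And>a. a \<in> A \<Longrightarrow> edg X v a" "\<And>a b. a \<in> A \<Longrightarrow> b \<in> A \<Longrightarrow> a \<noteq> b \<Longrightarrow> tri X v a b" for v A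
  proof -
    have "flag (cx_link X v)"
      using A large' unfolding k_large_def by blast
    moreover have "{a} \<in> cx_link X v" if "a \<in> A" for a
    proof -
      have "{v, a} \<in> X" "v \<noteq> a"
        using A(2)[OF that] by (auto simp: edg_def)
      moreover have "{a} \<in> X"
        by (rule simp_complex_face[OF K \<open>{v, a} \<in> X\<close>]) auto
      ultimately show ?thesis by (auto simp: cx_link_def)
    qed
    then have "A \<subseteq> vertices (cx_link X v)"
      by (auto simp: vertices_def)
    moreover have "\<forall>a\<in>A. \<forall>b\<in>A. a \<noteq> b \<longrightarrow> {a, b} \<in> cx_link X v"
      using A(3) by (auto simp: edge_in_link_iff_tri[OF K])
    ultimately have "A \<in> cx_link X v"
      using A(1) unfolding flag_def by blast
    then show ?thesis
      by (simp add: cx_link_def)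
  qed
  show "tri X v a c \<or> tri X v b d"
    if "tri X v a b" "tri X v b c" "tri X v c d" "tri X v d a" "a \<noteq> c" "b \<noteq> d" for v a b c d
    using link_4_cycle_diagonal[OF K large'' that] that(1) by blast
  show "tri X v a c \<or> tri X v b d \<or> tri X v c e \<or> tri X v d a \<or> tri X v e b"
    if "tri X v a b" "tri X v b c" "tri X v c d" "tri X v d e" "tri X v e a" "distinct [a, b, c, d, e]"
    for v a b c d e
    using link_5_cycle_diagonal[OF K large'' that] that(1) by blast
qed

theorem theorem4p3:
  fixes X :: "'a set set" and v0 :: 'a and n :: nat and \<sigma> :: "'a set"
  assumes "systolic X"
    and "v0 \<in> vertices X"
    and "n > 0"
    and "\<sigma> \<in> cx_sphere X v0 n"
  shows "\<exists>\<tau>\<in>X. cx_residue X \<sigma> \<inter> cx_sphere X v0 (n - 1) = full_simplex \<tau>"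
proof -
  interpret locally_6_large_complex X v0
    using assms(1) by (rule systolic_imp_locally_6_large_complex)
  interpret systolic_complex X v0
    by unfold_locales (use assms in \<open>auto simp: k_systolic_def\<close>)
  obtain k where "n = Suc k"
    using assms(3) by (cases n) auto
  then show ?thesis
    using residue_sphere_simplex assms(4) by simp
qed

end
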